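(* Let $G$ be a profinite group, $X$ a profinite $G$-space, and $\mathcal{B}$ the set of all compact-open subsets of $X$. For every $G$-equivariant presheaf of sets $F$ over $\mathcal{B}$, the sheaf space $\ell F\to X$ with its canonical $G$-action (described in the context) is a $G$-equivariant sheaf of sets over $X$, and this defines a functor $\ell$ (equivariant sheafification) from the category of $G$-equivariant presheaves of sets over $\mathcal{B}$ to the category of $G$-equivariant sheaves of sets over $X$, which is left adjoint to the forgetful functor. The functor $\mathrm{forget}\circ\ell$ is idempotent (the canonical map $\ell F\to\ell\ell F$ is an isomorphism for every $F$), hence the forgetful functor is fully faithful.
   Context: A profinite space is a compact, Hausdorff, totally disconnected space; a profinite group is a topological group whose underlying space is profinite. A $G$-space is a topological space with a continuous left $G$-action. $G$-sheaves: a $G$-equivariant sheaf of sets over $X$ is a $G$-equivariant local homeomorphism $p\colon E\to X$ with $E$ a $G$-space; morphisms are continuous $G$-equivariant maps over $X$. Its sections over an open $U$ are all continuous sections $s\colon U\to E$, and $g\in G$ sends $s$ to $g\ast s=g\circ s\circ g^{-1}\colon gU\to E$. $G$-presheaves: $\mathcal{O}_G(\mathcal{B})$ is the category with objects the elements of $\mathcal{B}$, morphism sets $\mathcal{O}_G(\mathcal{B})(U,V)=\{g\in G\mid gU\subseteq V\}$, and composition given by multiplication in $G$. A $G$-equivariant presheaf of sets over $\mathcal{B}$ is a functor $F\colon\mathcal{O}_G(\mathcal{B})^{op}\to\mathrm{Sets}$ such that for every $U\in\mathcal{B}$ the action of $\mathrm{stab}_G(U)=\{g\in G\mid gU=U\}$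 (subspace topology) on the set $F(U)$ (discrete topology) is continuous. Morphisms are natural transformations. For $s\in F(U)$ write $g\ast s\in F(gU)$ for the image of $s$ under $F(g^{-1})\colon F(U)\to F(gU)$. Forgetful functor: it sends a $G$-sheaf to the functor $U\mapsto\Gamma(U,E)$ on $\mathcal{B}$ with restriction maps and the maps $s\mapsto g\ast s$. Sheaf space: $\ell F=\coprod_{x\in X}F_x$, where $F_x=\operatorname{colim}_{x\in U\in\mathcal{B}}F(U)$ is the stalk, with projection $F_x\mapsto x$ and the topology generated by the sets $\{s_x\mid x\in U\}$ for $U\in\mathcal{B}$, $s\in F(U)$ ($s_x$ denotes the germ of $s$ at $x$). The canonical $G$-action is $g(s_x)=(g\ast s)_{gx}$. The canonical map $F\to \ell F$ is the unit of the adjunction, sending $s\in F(U)$ to the section $x\mapsto s_x$. *)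

theory Defs
  imports "HOL-Analysis.Analysis" "HOL-Algebra.Group_Action"
begin

section \<open>Profinite groups and spaces with a group action\<close>

definition totally_disconnected_space :: "'a topology \<Rightarrow> bool" where
  "totally_disconnected_space T \<longleftrightarrow>
     (\<forall>x \<in> topspace T. connected_component_of_set T x = {x})"

definition profinite_space :: "'a topology \<Rightarrow> bool" where
  "profinite_space T \<longleftrightarrow>
     compact_space T \<and> Hausdorff_space T \<and> totally_disconnected_space T"

definition topological_group :: "('g, 'm) monoid_scheme \<Rightarrow> 'g topology \<Rightarrow> bool" where
  "topological_group G TG \<longleftrightarrow>
     group G \<and> topspace TG = carrier G \<and>
     continuous_map (prod_topology TG TG) TG (\<lambda>(g, h). g \<otimes>\<^bsub>G\<^esub> h) \<and>
     continuous_map TG TG (\<lambda>g. inv\<^bsub>G\<^esub> g)"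

definition profinite_group :: "('g, 'm) monoid_scheme \<Rightarrow> 'g topology \<Rightarrow> bool" where
  "profinite_group G TG \<longleftrightarrow> topological_group G TG \<and> profinite_space TG"

definition G_space ::
  "('g, 'm) monoid_scheme \<Rightarrow> 'g topology \<Rightarrow> 'a topology \<Rightarrow> ('g \<Rightarrow> 'a \<Rightarrow> 'a) \<Rightarrow> bool" where
  "G_space G TG T a \<longleftrightarrow>
     group_action G (topspace T) a \<and>
     continuous_map (prod_topology TG T) T (\<lambda>(g, x). a g x)"

definition compact_opens :: "'x topology \<Rightarrow> 'x set set" where
  "compact_opens X = {U. openin X U \<and> compactin X U}"


section \<open>Equivariant presheaves over the compact-open sets\<close>

text \<open>
  Higher-order logic has no type of all sets, so the sets \<open>F(U)\<close> of a presheaf are subsets of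
  a type \<open>'c\<close>, and total spaces of sheaves are topologies on a type \<open>'e\<close>; both types are
  arbitrary. Hom-sets are defined between objects over possibly different types, so
  that all types together play the role of the category of sets. Morphisms are extensional
  functions, so that equality of morphisms is equality in the logic.

  The category \<open>O_G(B)\<close> has the hom-sets \<open>orbit_hom\<close>. For a morphism \<open>g\<close> from \<open>U\<close> to \<open>V\<close>,
  \<open>pull F U V g\<close> is the map \<open>F(g)\<close> from \<open>F(V)\<close> to \<open>F(U)\<close>.
\<close>

definition orbit_hom ::
  "('g, 'm) monoid_scheme \<Rightarrow> ('g \<Rightarrow> 'x \<Rightarrow> 'x) \<Rightarrow> 'x set \<Rightarrow> 'x set \<Rightarrow> 'g set" where
  "orbit_hom G act U V = {g \<in> carrier G. act g ` U \<subseteq> V}"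

record ('g, 'x, 'c) presheaf =
  sect :: "'x set \<Rightarrow> 'c set"
  pull :: "'x set \<Rightarrow> 'x set \<Rightarrow> 'g \<Rightarrow> 'c \<Rightarrow> 'c"

definition pre_star ::
  "('g, 'm) monoid_scheme \<Rightarrow> ('g \<Rightarrow> 'x \<Rightarrow> 'x) \<Rightarrow> ('g, 'x, 'c) presheaf \<Rightarrow>
     'x set \<Rightarrow> 'g \<Rightarrow> 'c \<Rightarrow> 'c" where
  "pre_star G act F U g s = pull F (act g ` U) U (inv\<^bsub>G\<^esub> g) s"

definition G_presheaf ::
  "('g, 'm) monoid_scheme \<Rightarrow> 'g topology \<Rightarrow> 'x topology \<Rightarrow> ('g \<Rightarrow> 'x \<Rightarrow> 'x) \<Rightarrow>
     ('g, 'x, 'c) presheaf \<Rightarrow> bool" where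
  "G_presheaf G TG X act F \<longleftrightarrow>
     (\<forall>U \<in> compact_opens X. \<forall>V \<in> compact_opens X. \<forall>g \<in> orbit_hom G act U V.
        pull F U V g \<in> sect F V \<rightarrow> sect F U) \<and>
     (\<forall>U \<in> compact_opens X. \<forall>s \<in> sect F U. pull F U U \<one>\<^bsub>G\<^esub> s = s) \<and>
     (\<forall>U \<in> compact_opens X. \<forall>V \<in> compact_opens X. \<forall>W \<in> compact_opens X.
        \<forall>g \<in> orbit_hom G act U V. \<forall>h \<in> orbit_hom G act V W. \<forall>s \<in> sect F W.
          pull F U W (h \<otimes>\<^bsub>G\<^esub> g) s = pull F U V g (pull F V W h s)) \<and>
     (\<forall>U \<in> compact_opens X.
        continuous_map
          (prod_topology (subtopology TG (stabilizer G (\<lambda>g. (`) (act g)) U))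
                         (discrete_topology (sect F U)))
          (discrete_topology (sect F U))
          (\<lambda>(g, s). pre_star G act F U g s))"

definition presheaf_hom ::
  "('g, 'm) monoid_scheme \<Rightarrow> 'x topology \<Rightarrow> ('g \<Rightarrow> 'x \<Rightarrow> 'x) \<Rightarrow>
     ('g, 'x, 'c) presheaf \<Rightarrow> ('g, 'x, 'd) presheaf \<Rightarrow> ('x set \<Rightarrow> 'c \<Rightarrow> 'd) set" where
  "presheaf_hom G X act F F' =
     {\<phi> \<in> (\<Pi>\<^sub>E U \<in> compact_opens X. sect F U \<rightarrow>\<^sub>E sect F' U).
        \<forall>U \<in> compact_opens X. \<forall>V \<in> compact_opens X. \<forall>g \<in> orbit_hom G act U V. \<forall>s \<in> sect F V.
          \<phi> U (pull F U V g s) = pull F' U V g (\<phi> V s)}"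

definition presheaf_id :: "'x topology \<Rightarrow> ('g, 'x, 'c) presheaf \<Rightarrow> 'x set \<Rightarrow> 'c \<Rightarrow> 'c" where
  "presheaf_id X F = (\<lambda>U \<in> compact_opens X. \<lambda>s \<in> sect F U. s)"

text \<open>The argument \<open>F\<close> is the source of \<open>\<phi>\<close>.\<close>

definition presheaf_comp ::
  "'x topology \<Rightarrow> ('g, 'x, 'c) presheaf \<Rightarrow> ('x set \<Rightarrow> 'd \<Rightarrow> 'k) \<Rightarrow> ('x set \<Rightarrow> 'c \<Rightarrow> 'd) \<Rightarrow>
     'x set \<Rightarrow> 'c \<Rightarrow> 'k" where
  "presheaf_comp X F \<psi> \<phi> = (\<lambda>U \<in> compact_opens X. compose (sect F U) (\<psi> U) (\<phi> U))"

definition presheaf_iso ::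
  "('g, 'm) monoid_scheme \<Rightarrow> 'x topology \<Rightarrow> ('g \<Rightarrow> 'x \<Rightarrow> 'x) \<Rightarrow>
     ('g, 'x, 'c) presheaf \<Rightarrow> ('g, 'x, 'd) presheaf \<Rightarrow> ('x set \<Rightarrow> 'c \<Rightarrow> 'd) \<Rightarrow> bool" where
  "presheaf_iso G X act F F' \<phi> \<longleftrightarrow>
     \<phi> \<in> presheaf_hom G X act F F' \<and>
     (\<exists>\<psi> \<in> presheaf_hom G X act F' F.
        presheaf_comp X F \<psi> \<phi> = presheaf_id X F \<and> presheaf_comp X F' \<phi> \<psi> = presheaf_id X F')"


section \<open>Equivariant sheaves\<close>

definition local_homeomorphism :: "'e topology \<Rightarrow> 'x topology \<Rightarrow> ('e \<Rightarrow> 'x) \<Rightarrow> bool" where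
  "local_homeomorphism E X p \<longleftrightarrow>
     (\<forall>e \<in> topspace E. \<exists>N. openin E N \<and> e \<in> N \<and> openin X (p ` N) \<and>
        homeomorphic_map (subtopology E N) (subtopology X (p ` N)) p)"

record ('g, 'x, 'e) sheaf =
  total :: "'e topology"
  proj :: "'e \<Rightarrow> 'x"
  gact :: "'g \<Rightarrow> 'e \<Rightarrow> 'e"

definition G_sheaf ::
  "('g, 'm) monoid_scheme \<Rightarrow> 'g topology \<Rightarrow> 'x topology \<Rightarrow> ('g \<Rightarrow> 'x \<Rightarrow> 'x) \<Rightarrow>
     ('g, 'x, 'e) sheaf \<Rightarrow> bool" where
  "G_sheaf G TG X act E \<longleftrightarrow>
     G_space G TG (total E) (gact E) \<and>
     local_homeomorphism (total E) X (proj E) \<and>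
     (\<forall>g \<in> carrier G. \<forall>e \<in> topspace (total E). proj E (gact E g e) = act g (proj E e))"

definition sheaf_hom ::
  "('g, 'm) monoid_scheme \<Rightarrow> ('g, 'x, 'e) sheaf \<Rightarrow> ('g, 'x, 'f) sheaf \<Rightarrow> ('e \<Rightarrow> 'f) set" where
  "sheaf_hom G E E' =
     {f \<in> extensional (topspace (total E)).
        continuous_map (total E) (total E') f \<and>
        (\<forall>e \<in> topspace (total E). proj E' (f e) = proj E e) \<and>
        (\<forall>g \<in> carrier G. \<forall>e \<in> topspace (total E). f (gact E g e) = gact E' g (f e))}"

definition sheaf_id :: "('g, 'x, 'e) sheaf \<Rightarrow> 'e \<Rightarrow> 'e" where
  "sheaf_id E = (\<lambda>e \<in> topspace (total E). e)"

definition sheaf_comp ::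
  "('g, 'x, 'e) sheaf \<Rightarrow> ('f \<Rightarrow> 'h) \<Rightarrow> ('e \<Rightarrow> 'f) \<Rightarrow> 'e \<Rightarrow> 'h" where
  "sheaf_comp E f' f = compose (topspace (total E)) f' f"

definition sheaf_iso ::
  "('g, 'm) monoid_scheme \<Rightarrow> ('g, 'x, 'e) sheaf \<Rightarrow> ('g, 'x, 'f) sheaf \<Rightarrow> ('e \<Rightarrow> 'f) \<Rightarrow> bool" where
  "sheaf_iso G E E' f \<longleftrightarrow>
     f \<in> sheaf_hom G E E' \<and>
     (\<exists>f' \<in> sheaf_hom G E' E.
        sheaf_comp E f' f = sheaf_id E \<and> sheaf_comp E' f f' = sheaf_id E')"


section \<open>The forgetful functor\<close>

definition sections :: "'x topology \<Rightarrow> ('g, 'x, 'e) sheaf \<Rightarrow> 'x set \<Rightarrow> ('x \<Rightarrow> 'e) set" where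
  "sections X E U =
     {s \<in> extensional U. continuous_map (subtopology X U) (total E) s \<and>
        (\<forall>x \<in> U. proj E (s x) = x)}"

definition section_star ::
  "('g, 'm) monoid_scheme \<Rightarrow> ('g \<Rightarrow> 'x \<Rightarrow> 'x) \<Rightarrow> ('g, 'x, 'e) sheaf \<Rightarrow>
     'x set \<Rightarrow> 'g \<Rightarrow> ('x \<Rightarrow> 'e) \<Rightarrow> 'x \<Rightarrow> 'e" where
  "section_star G act E U g s = (\<lambda>x \<in> act g ` U. gact E g (s (act (inv\<^bsub>G\<^esub> g) x)))"

text \<open>
  Since \<open>g * s\<close> is the image of \<open>s\<close> under the inverse of \<open>g\<close>, a morphism \<open>g\<close> from \<open>U\<close> to \<open>V\<close>
  sends a section over \<open>V\<close> to the restriction of its translate by the inverse of \<open>g\<close>.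
\<close>

definition forget ::
  "('g, 'm) monoid_scheme \<Rightarrow> 'x topology \<Rightarrow> ('g \<Rightarrow> 'x \<Rightarrow> 'x) \<Rightarrow> ('g, 'x, 'e) sheaf \<Rightarrow>
     ('g, 'x, 'x \<Rightarrow> 'e) presheaf" where
  "forget G X act E =
     \<lparr>sect = sections X E,
      pull = (\<lambda>U V g s. restrict (section_star G act E V (inv\<^bsub>G\<^esub> g) s) U)\<rparr>"

definition forget_map ::
  "'x topology \<Rightarrow> ('g, 'x, 'e) sheaf \<Rightarrow> ('e \<Rightarrow> 'f) \<Rightarrow> 'x set \<Rightarrow> ('x \<Rightarrow> 'e) \<Rightarrow> 'x \<Rightarrow> 'f" where
  "forget_map X E f = (\<lambda>U \<in> compact_opens X. \<lambda>s \<in> sections X E U. compose U f s)"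


section \<open>Equivariant sheafification\<close>

text \<open>
  The stalk at \<open>x\<close> is the usual quotient of pairs \<open>(U, s)\<close> computing the filtered colimit;
  points of the sheaf space carry their base point as first component.
\<close>

definition germ_rel ::
  "('g, 'm) monoid_scheme \<Rightarrow> 'x topology \<Rightarrow> ('g, 'x, 'c) presheaf \<Rightarrow> 'x \<Rightarrow>
     (('x set \<times> 'c) \<times> ('x set \<times> 'c)) set" where
  "germ_rel G X F x =
     {((U, s), (V, t)).
        U \<in> compact_opens X \<and> x \<in> U \<and> s \<in> sect F U \<and>
        V \<in> compact_opens X \<and> x \<in> V \<and> t \<in> sect F V \<and>
        (\<exists>W \<in> compact_opens X. x \<in> W \<and> W \<subseteq> U \<inter> V \<and>
           pull F W U \<one>\<^bsub>G\<^esub> s = pull F W V \<one>\<^bsub>G\<^esub> t)}"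

definition stalk ::
  "('g, 'm) monoid_scheme \<Rightarrow> 'x topology \<Rightarrow> ('g, 'x, 'c) presheaf \<Rightarrow> 'x \<Rightarrow>
     ('x set \<times> 'c) set set" where
  "stalk G X F x = (SIGMA U : {U \<in> compact_opens X. x \<in> U}. sect F U) // germ_rel G X F x"

type_synonym ('x, 'c) germ = "'x \<times> ('x set \<times> 'c) set"

definition germ ::
  "('g, 'm) monoid_scheme \<Rightarrow> 'x topology \<Rightarrow> ('g, 'x, 'c) presheaf \<Rightarrow>
     'x set \<Rightarrow> 'c \<Rightarrow> 'x \<Rightarrow> ('x, 'c) germ" where
  "germ G X F U s x = (x, germ_rel G X F x `` {(U, s)})"

definition sheaf_space ::
  "('g, 'm) monoid_scheme \<Rightarrow> 'x topology \<Rightarrow> ('g, 'x, 'c) presheaf \<Rightarrow>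
     ('x, 'c) germ topology" where
  "sheaf_space G X F =
     topology_generated_by {germ G X F U s ` U | U s. U \<in> compact_opens X \<and> s \<in> sect F U}"

definition germ_act ::
  "('g, 'm) monoid_scheme \<Rightarrow> 'x topology \<Rightarrow> ('g \<Rightarrow> 'x \<Rightarrow> 'x) \<Rightarrow> ('g, 'x, 'c) presheaf \<Rightarrow>
     'g \<Rightarrow> ('x, 'c) germ \<Rightarrow> ('x, 'c) germ" where
  "germ_act G X act F g =
     (\<lambda>p \<in> topspace (sheaf_space G X F).
        THE q. \<exists>U \<in> compact_opens X. \<exists>s \<in> sect F U. \<exists>x \<in> U.
          p = germ G X F U s x \<and>
          q = germ G X F (act g ` U) (pre_star G act F U g s) (act g x))"

definition sheafify ::
  "('g, 'm) monoid_scheme \<Rightarrow> 'x topology \<Rightarrow> ('g \<Rightarrow> 'x \<Rightarrow> 'x) \<Rightarrow> ('g, 'x, 'c) presheaf \<Rightarrow>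
     ('g, 'x, ('x, 'c) germ) sheaf" where
  "sheafify G X act F =
     \<lparr>total = sheaf_space G X F, proj = fst, gact = germ_act G X act F\<rparr>"

definition sheafify_map ::
  "('g, 'm) monoid_scheme \<Rightarrow> 'x topology \<Rightarrow> ('g, 'x, 'c) presheaf \<Rightarrow> ('g, 'x, 'd) presheaf \<Rightarrow>
     ('x set \<Rightarrow> 'c \<Rightarrow> 'd) \<Rightarrow> ('x, 'c) germ \<Rightarrow> ('x, 'd) germ" where
  "sheafify_map G X F F' \<phi> =
     (\<lambda>p \<in> topspace (sheaf_space G X F).
        THE q. \<exists>U \<in> compact_opens X. \<exists>s \<in> sect F U. \<exists>x \<in> U.
          p = germ G X F U s x \<and> q = germ G X F' U (\<phi> U s) x)"

definition sheafify_unit ::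
  "('g, 'm) monoid_scheme \<Rightarrow> 'x topology \<Rightarrow> ('g, 'x, 'c) presheaf \<Rightarrow>
     'x set \<Rightarrow> 'c \<Rightarrow> 'x \<Rightarrow> ('x, 'c) germ" where
  "sheafify_unit G X F =
     (\<lambda>U \<in> compact_opens X. \<lambda>s \<in> sect F U. \<lambda>x \<in> U. germ G X F U s x)"

definition transpose_hom ::
  "('g, 'm) monoid_scheme \<Rightarrow> 'x topology \<Rightarrow> ('g \<Rightarrow> 'x \<Rightarrow> 'x) \<Rightarrow> ('g, 'x, 'c) presheaf \<Rightarrow>
     (('x, 'c) germ \<Rightarrow> 'e) \<Rightarrow> 'x set \<Rightarrow> 'c \<Rightarrow> 'x \<Rightarrow> 'e" where
  "transpose_hom G X act F f =
     presheaf_comp X F (forget_map X (sheafify G X act F) f) (sheafify_unit G X F)"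


section \<open>Category laws and well-definedness\<close>

lemma pull_closed:
  assumes "G_presheaf G TG X act F"
    and "U \<in> compact_opens X" "V \<in> compact_opens X" "g \<in> orbit_hom G act U V" "s \<in> sect F V"
  shows "pull F U V g s \<in> sect F U"
  using funcset_mem[OF bspec[OF bspec[OF bspec[OF conjunct1[OF iffD1[OF G_presheaf_def assms(1)]]
            assms(2)] assms(3)] assms(4)] assms(5)] .

lemma pull_pull:
  assumes "G_presheaf G TG X act F"
    and "U \<in> compact_opens X" "V \<in> compact_opens X" "W \<in> compact_opens X"
    and "g \<in> orbit_hom G act U V" "h \<in> orbit_hom G act V W" "s \<in> sect F W"
  shows "pull F U V g (pull F V W h s) = pull F U W (h \<otimes>\<^bsub>G\<^esub> g) s"
  using bspec[OF bspec[OF bspec[OF bspec[OF bspec[OF bspec[OF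
          conjunct1[OF conjunct2[OF conjunct2[OF iffD1[OF G_presheaf_def assms(1)]]]]
          assms(2)] assms(3)] assms(4)] assms(5)] assms(6)] assms(7)] by (rule sym)

lemma presheaf_hom_closed:
  assumes "\<phi> \<in> presheaf_hom G X act F F'" "U \<in> compact_opens X" "s \<in> sect F U"
  shows "\<phi> U s \<in> sect F' U"
  using assms PiE_mem unfolding presheaf_hom_def by fast

lemma presheaf_hom_natural:
  assumes "\<phi> \<in> presheaf_hom G X act F F'"
    and "U \<in> compact_opens X" "V \<in> compact_opens X" "g \<in> orbit_hom G act U V" "s \<in> sect F V"
  shows "\<phi> U (pull F U V g s) = pull F' U V g (\<phi> V s)"
  using assms unfolding presheaf_hom_def by simp

lemma presheaf_homI:
  assumes "\<And>U s. U \<in> compact_opens X \<Longrightarrow> s \<in> sect F U \<Longrightarrow> \<phi> U s \<in> sect F' U"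
    and "\<And>U s. U \<in> compact_opens X \<Longrightarrow> s \<notin> sect F U \<Longrightarrow> \<phi> U s = undefined"
    and "\<And>U. U \<notin> compact_opens X \<Longrightarrow> \<phi> U = undefined"
    and "\<And>U V g s. \<lbrakk>U \<in> compact_opens X; V \<in> compact_opens X; g \<in> orbit_hom G act U V; s \<in> sect F V\<rbrakk>
           \<Longrightarrow> \<phi> U (pull F U V g s) = pull F' U V g (\<phi> V s)"
  shows "\<phi> \<in> presheaf_hom G X act F F'"
proof -
  have "\<phi> \<in> (\<Pi>\<^sub>E U \<in> compact_opens X. sect F U \<rightarrow>\<^sub>E sect F' U)"
    by (intro PiE_I assms(1-3))
  moreover have "\<forall>U \<in> compact_opens X. \<forall>V \<in> compact_opens X. \<forall>g \<in> orbit_hom G act U V.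
      \<forall>s \<in> sect F V. \<phi> U (pull F U V g s) = pull F' U V g (\<phi> V s)"
    by (intro ballI assms(4))
  ultimately show ?thesis
    unfolding presheaf_hom_def mem_Collect_eq by (rule conjI)
qed

lemma presheaf_id_in_hom:
  assumes "G_presheaf G TG X act F"
  shows "presheaf_id X F \<in> presheaf_hom G X act F F"
  by (rule presheaf_homI) (simp_all add: presheaf_id_def pull_closed[OF assms])

lemma presheaf_comp_in_hom:
  assumes "G_presheaf G TG X act F"
    and "\<phi> \<in> presheaf_hom G X act F F'" and "\<psi> \<in> presheaf_hom G X act F' F''"
  shows "presheaf_comp X F \<psi> \<phi> \<in> presheaf_hom G X act F F''"
  by (rule presheaf_homI)
    (simp_all add: presheaf_comp_def compose_def pull_closed[OF assms(1)]
      presheaf_hom_closed[OF assms(2)] presheaf_hom_closed[OF assms(3)]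
      presheaf_hom_natural[OF assms(2)] presheaf_hom_natural[OF assms(3)])

lemma presheaf_comp_id:
  assumes "\<phi> \<in> presheaf_hom G X act F F'"
  shows "presheaf_comp X F \<phi> (presheaf_id X F) = \<phi>"
    and "presheaf_comp X F (presheaf_id X F') \<phi> = \<phi>"
proof -
  have \<phi>: "\<phi> \<in> (\<Pi>\<^sub>E U \<in> compact_opens X. sect F U \<rightarrow>\<^sub>E sect F' U)"
    using assms unfolding presheaf_hom_def mem_Collect_eq by (rule conjunct1)
  have 1: "\<phi> U s = undefined" if "U \<in> compact_opens X" "s \<notin> sect F U" for U s
    by (rule PiE_arb[OF PiE_mem[OF \<phi> that(1)] that(2)])
  have 2: "\<phi> U = undefined" if "U \<notin> compact_opens X" for U
    by (rule PiE_arb[OF \<phi> that])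
  show "presheaf_comp X F \<phi> (presheaf_id X F) = \<phi>"
    by (rule ext, rule ext) (simp add: presheaf_comp_def presheaf_id_def compose_def restrict_def 1 2)
  show "presheaf_comp X F (presheaf_id X F') \<phi> = \<phi>"
    by (rule ext, rule ext) (simp add: presheaf_comp_def presheaf_id_def compose_def restrict_def 1 2
        presheaf_hom_closed[OF assms])
qed

lemma presheaf_comp_assoc:
  assumes "\<phi> \<in> presheaf_hom G X act F F'"
  shows "presheaf_comp X F \<theta> (presheaf_comp X F \<psi> \<phi>) = presheaf_comp X F (presheaf_comp X F' \<theta> \<psi>) \<phi>"
  by (rule ext, rule ext)
    (simp add: presheaf_comp_def compose_def restrict_def presheaf_hom_closed[OF assms])

lemma gact_closed:
  assumes "G_sheaf G TG X act E" and "g \<in> carrier G" and "e \<in> topspace (total E)"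
  shows "gact E g e \<in> topspace (total E)"
proof -
  have "group_action G (topspace (total E)) (gact E)"
    using assms(1) by (simp add: G_sheaf_def G_space_def)
  from group_action.element_image[OF this assms(2,3) refl] show ?thesis .
qed

lemma sheaf_hom_closed:
  assumes "f \<in> sheaf_hom G E E'" and "e \<in> topspace (total E)"
  shows "f e \<in> topspace (total E')"
  using assms by (simp add: sheaf_hom_def continuous_map_def Pi_iff)

lemma sheaf_id_in_hom:
  assumes "G_sheaf G TG X act E"
  shows "sheaf_id E \<in> sheaf_hom G E E"
proof -
  have "continuous_map (total E) (total E) (sheaf_id E)"
    by (rule continuous_map_eq[OF continuous_map_id]) (simp add: sheaf_id_def)
  then show ?thesis
    by (simp add: sheaf_hom_def sheaf_id_def gact_closed[OF assms])
qed

lemma sheaf_comp_in_hom: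
  assumes "G_sheaf G TG X act E" and "f \<in> sheaf_hom G E E'" and "f' \<in> sheaf_hom G E' E''"
  shows "sheaf_comp E f' f \<in> sheaf_hom G E E''"
proof -
  have "continuous_map (total E) (total E'') (f' \<circ> f)"
    using assms(2,3) by (intro continuous_map_compose[of _ "total E'"]) (simp_all add: sheaf_hom_def)
  then have "continuous_map (total E) (total E'') (sheaf_comp E f' f)"
    by (rule continuous_map_eq) (simp add: sheaf_comp_def compose_eq)
  then show ?thesis
    using assms(2,3) sheaf_hom_closed[OF assms(2)]
    by (simp add: sheaf_hom_def sheaf_comp_def compose_eq gact_closed[OF assms(1)])
qed

lemma sheaf_comp_id:
  assumes "f \<in> sheaf_hom G E E'"
  shows "sheaf_comp E f (sheaf_id E) = f" and "sheaf_comp E (sheaf_id E') f = f"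
proof -
  have 1: "f e = undefined" if "e \<notin> topspace (total E)" for e
    using assms that by (simp add: sheaf_hom_def extensional_def)
  show "sheaf_comp E f (sheaf_id E) = f"
    by (rule ext) (simp add: sheaf_comp_def sheaf_id_def compose_def restrict_def 1)
  show "sheaf_comp E (sheaf_id E') f = f"
    by (rule ext) (simp add: sheaf_comp_def sheaf_id_def compose_def restrict_def 1
        sheaf_hom_closed[OF assms])
qed

lemma sheaf_comp_assoc:
  assumes "f \<in> sheaf_hom G E E'"
  shows "sheaf_comp E f'' (sheaf_comp E f' f) = sheaf_comp E (sheaf_comp E' f'' f') f"
  by (rule ext) (simp add: sheaf_comp_def compose_def restrict_def sheaf_hom_closed[OF assms])

lemma topspace_sheaf_space:
  "topspace (sheaf_space G X F) = (SIGMA x : topspace X. stalk G X F x)"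
proof -
  have sub: "U \<subseteq> topspace X" if "U \<in> compact_opens X" for U
    using that openin_subset unfolding compact_opens_def by blast
  have "p \<in> topspace (sheaf_space G X F) \<longleftrightarrow>
      (\<exists>U \<in> compact_opens X. \<exists>s \<in> sect F U. \<exists>x \<in> U. p = germ G X F U s x)" for p
    unfolding sheaf_space_def topology_generated_by_topspace by blast
  moreover have "p \<in> (SIGMA x : topspace X. stalk G X F x) \<longleftrightarrow>
      (\<exists>U \<in> compact_opens X. \<exists>s \<in> sect F U. \<exists>x \<in> U. p = germ G X F U s x)" for p
    unfolding germ_def stalk_def quotient_def using sub by (cases p) fast
  ultimately show ?thesis
    by blast
qed

lemma orbit_homI: "g \<in> carrier G \<Longrightarrow> act g ` U \<subseteq> V \<Longrightarrow> g \<in> orbit_hom G act U V"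
  by (simp add: orbit_hom_def)

lemma
  assumes "G_space G TG X act"
  shows G_space_group: "group G"
    and act_one: "x \<in> topspace X \<Longrightarrow> act \<one>\<^bsub>G\<^esub> x = x"
    and act_closed: "g \<in> carrier G \<Longrightarrow> x \<in> topspace X \<Longrightarrow> act g x \<in> topspace X"
    and act_inv: "g \<in> carrier G \<Longrightarrow> x \<in> topspace X \<Longrightarrow> act (inv\<^bsub>G\<^esub> g) (act g x) = x"
    and act_inv': "g \<in> carrier G \<Longrightarrow> x \<in> topspace X \<Longrightarrow> act g (act (inv\<^bsub>G\<^esub> g) x) = x"
proof -
  interpret A: group_action G "topspace X" act
    using assms by (simp add: G_space_def)
  show g: "group G"
    using A.group_hom by (simp add: group_hom_def)
  interpret group G by (rule g)
  show one: "act \<one>\<^bsub>G\<^esub> x = x" if "x \<in> topspace X" for x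
    using that A.id_eq_one by (metis restrict_apply')
  show "g \<in> carrier G \<Longrightarrow> x \<in> topspace X \<Longrightarrow> act g x \<in> topspace X"
    by (rule A.element_image) auto
  show "g \<in> carrier G \<Longrightarrow> x \<in> topspace X \<Longrightarrow> act (inv\<^bsub>G\<^esub> g) (act g x) = x"
    by (metis A.composition_rule inv_closed l_inv one)
  show "g \<in> carrier G \<Longrightarrow> x \<in> topspace X \<Longrightarrow> act g (act (inv\<^bsub>G\<^esub> g) x) = x"
    by (metis A.composition_rule inv_closed r_inv one)
qed

lemma act_compact_opens:
  assumes "G_space G TG X act" "topspace TG = carrier G" "g \<in> carrier G" "U \<in> compact_opens X"
  shows "act g ` U \<in> compact_opens X"
proof -
  interpret group G by (rule G_space_group[OF assms(1)])
  have c: "continuous_map X X (act h)" if "h \<in> carrier G" for h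
  proof -
    have "continuous_map X (prod_topology TG X) (\<lambda>x. (h, x))"
      using that assms(2) by (intro continuous_map_pairedI) auto
    from continuous_map_compose[OF this] assms(1) show ?thesis
      unfolding G_space_def by (fastforce simp: o_def)
  qed
  have sub: "U \<subseteq> topspace X"
    using assms(4) openin_subset unfolding compact_opens_def by blast
  have "act g ` U = {x \<in> topspace X. act (inv\<^bsub>G\<^esub> g) x \<in> U}"
    using assms(1,3) sub by (force simp: act_closed act_inv act_inv' image_iff)
  moreover have "openin X {x \<in> topspace X. act (inv\<^bsub>G\<^esub> g) x \<in> U}"
    using openin_continuous_map_preimage[OF c] assms(3,4) unfolding compact_opens_def by auto
  ultimately have "openin X (act g ` U)"
    by simp
  moreover have "compactin X (act g ` U)"
    using image_compactin[OF _ c[OF assms(3)]] assms(4) unfolding compact_opens_def by blast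
  ultimately show ?thesis
    by (simp add: compact_opens_def)
qed

lemma one_orbit_hom:
  assumes "G_space G TG X act" "U \<in> compact_opens X" "U \<subseteq> V"
  shows "\<one>\<^bsub>G\<^esub> \<in> orbit_hom G act U V"
proof -
  interpret group G by (rule G_space_group[OF assms(1)])
  have "U \<subseteq> topspace X"
    using assms(2) openin_subset unfolding compact_opens_def by blast
  then have "act \<one>\<^bsub>G\<^esub> x = x" if "x \<in> U" for x
    using act_one[OF assms(1)] that by blast
  then show ?thesis
    using assms(3) by (intro orbit_homI) auto
qed

lemma equiv_germ_rel:
  assumes "G_space G TG X act" "G_presheaf G TG X act F" "Hausdorff_space X"
  shows "equiv (SIGMA U : {U \<in> compact_opens X. x \<in> U}. sect F U) (germ_rel G X F x)"
proof (rule equivI)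
  interpret group G by (rule G_space_group[OF assms(1)])
  show "germ_rel G X F x \<subseteq>
      (SIGMA U : {U \<in> compact_opens X. x \<in> U}. sect F U) \<times>
      (SIGMA U : {U \<in> compact_opens X. x \<in> U}. sect F U)"
    by (auto simp: germ_rel_def)
  show "refl_on (SIGMA U : {U \<in> compact_opens X. x \<in> U}. sect F U) (germ_rel G X F x)"
    by (force simp: germ_rel_def refl_on_def)
  show "sym (germ_rel G X F x)"
    by (auto simp: germ_rel_def sym_def)
  show "trans (germ_rel G X F x)"
  proof (rule transI)
    fix p q r
    assume "(p, q) \<in> germ_rel G X F x" and "(q, r) \<in> germ_rel G X F x"
    then obtain U s V t U' s' W W'
      where pqr: "p = (U, s)" "q = (V, t)" "r = (U', s')" "x \<in> U" "x \<in> U'"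
      and *: "U \<in> compact_opens X" "s \<in> sect F U" "V \<in> compact_opens X" "t \<in> sect F V"
      "U' \<in> compact_opens X" "s' \<in> sect F U'"
      and W: "W \<in> compact_opens X" "x \<in> W" "W \<subseteq> U" "W \<subseteq> V"
        "pull F W U \<one>\<^bsub>G\<^esub> s = pull F W V \<one>\<^bsub>G\<^esub> t"
      and W': "W' \<in> compact_opens X" "x \<in> W'" "W' \<subseteq> V" "W' \<subseteq> U'"
        "pull F W' V \<one>\<^bsub>G\<^esub> t = pull F W' U' \<one>\<^bsub>G\<^esub> s'"
      unfolding germ_rel_def by fast
    let ?Z = "W \<inter> W'"
    have Z: "?Z \<in> compact_opens X"
      using W(1) W'(1) assms(3) unfolding compact_opens_def
      by (auto intro: closed_Int_compactin compactin_imp_closedin)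
    have r: "pull F ?Z B \<one>\<^bsub>G\<^esub> c = pull F ?Z A \<one>\<^bsub>G\<^esub> (pull F A B \<one>\<^bsub>G\<^esub> c)"
      if "A \<in> compact_opens X" "B \<in> compact_opens X" "?Z \<subseteq> A" "A \<subseteq> B" "c \<in> sect F B" for A B c
      using pull_pull[OF assms(2) Z that(1,2)] one_orbit_hom[OF assms(1)] that Z by simp
    have "pull F ?Z U \<one>\<^bsub>G\<^esub> s = pull F ?Z V \<one>\<^bsub>G\<^esub> t"
      using r[OF W(1) *(1) _ W(3) *(2)] r[OF W(1) *(3) _ W(4) *(4)] W(5) by simp
    moreover have "pull F ?Z V \<one>\<^bsub>G\<^esub> t = pull F ?Z U' \<one>\<^bsub>G\<^esub> s'"
      using r[OF W'(1) *(3) _ W'(3) *(4)] r[OF W'(1) *(5) _ W'(4) *(6)] W'(5) by simp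
    ultimately have "\<exists>W \<in> compact_opens X. x \<in> W \<and> W \<subseteq> U \<inter> U' \<and>
        pull F W U \<one>\<^bsub>G\<^esub> s = pull F W U' \<one>\<^bsub>G\<^esub> s'"
      using Z W(2,3) W'(2,4) by (intro bexI[of _ ?Z] conjI) auto
    then show "(p, r) \<in> germ_rel G X F x"
      using pqr * by (simp add: germ_rel_def)
  qed
qed

lemma germ_eq_iff:
  assumes "G_space G TG X act" "G_presheaf G TG X act F" "Hausdorff_space X"
    and "U \<in> compact_opens X" "x \<in> U" "s \<in> sect F U"
    and "V \<in> compact_opens X" "y \<in> V" "t \<in> sect F V"
  shows "germ G X F U s x = germ G X F V t y \<longleftrightarrow> x = y \<and> ((U, s), (V, t)) \<in> germ_rel G X F x"
  using eq_equiv_class_iff[OF equiv_germ_rel[OF assms(1-3)], of "(U, s)" x "(V, t)"] assms(4-9)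
  by (auto simp: germ_def)

lemma germ_in_topspace:
  assumes "U \<in> compact_opens X" "x \<in> U" "s \<in> sect F U"
  shows "germ G X F U s x \<in> topspace (sheaf_space G X F)"
  unfolding sheaf_space_def topology_generated_by_topspace using assms by blast

lemma germ_act_germ:
  assumes "G_space G TG X act" "topspace TG = carrier G" "G_presheaf G TG X act F" "Hausdorff_space X"
    and "g \<in> carrier G" "U \<in> compact_opens X" "s \<in> sect F U" "x \<in> U"
  shows "germ_act G X act F g (germ G X F U s x) =
           germ G X F (act g ` U) (pre_star G act F U g s) (act g x)"
proof -
  interpret group G by (rule G_space_group[OF assms(1)])
  have top: "V \<subseteq> topspace X" if "V \<in> compact_opens X" for V
    using that openin_subset unfolding compact_opens_def by blast
  have im: "act g ` V \<in> compact_opens X" if "V \<in> compact_opens X" for V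
    using act_compact_opens[OF assms(1,2,5) that] .
  have ginv: "inv\<^bsub>G\<^esub> g \<in> orbit_hom G act (act g ` V) V" if "V \<in> compact_opens X" for V
    using top[OF that] assms(1,5) by (intro orbit_homI) (auto simp: act_inv subset_iff)
  have star: "pre_star G act F V g t \<in> sect F (act g ` V)" if "V \<in> compact_opens X" "t \<in> sect F V" for V t
    unfolding pre_star_def using pull_closed[OF assms(3) im[OF that(1)] that(1) ginv[OF that(1)] that(2)] .
  have res: "pull F (act g ` W) (act g ` V) \<one>\<^bsub>G\<^esub> (pre_star G act F V g t) =
             pull F (act g ` W) W (inv\<^bsub>G\<^esub> g) (pull F W V \<one>\<^bsub>G\<^esub> t)"
    if "W \<in> compact_opens X" "V \<in> compact_opens X" "W \<subseteq> V" "t \<in> sect F V" for W V t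
  proof -
    have 1: "\<one>\<^bsub>G\<^esub> \<in> orbit_hom G act (act g ` W) (act g ` V)"
      using that by (intro one_orbit_hom[OF assms(1)] im) auto
    show ?thesis
      unfolding pre_star_def
      using pull_pull[OF assms(3) im[OF that(1)] im[OF that(2)] that(2) 1 ginv[OF that(2)] that(4)]
        pull_pull[OF assms(3) im[OF that(1)] that(1,2) ginv[OF that(1)] one_orbit_hom[OF assms(1) that(1,3)] that(4)]
        assms(5) by simp
  qed
  have "(THE q. \<exists>V \<in> compact_opens X. \<exists>t \<in> sect F V. \<exists>y \<in> V.
          germ G X F U s x = germ G X F V t y \<and>
          q = germ G X F (act g ` V) (pre_star G act F V g t) (act g y)) =
        germ G X F (act g ` U) (pre_star G act F U g s) (act g x)"
  proof (rule the_equality)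
    show "\<exists>V \<in> compact_opens X. \<exists>t \<in> sect F V. \<exists>y \<in> V.
          germ G X F U s x = germ G X F V t y \<and>
          germ G X F (act g ` U) (pre_star G act F U g s) (act g x) =
            germ G X F (act g ` V) (pre_star G act F V g t) (act g y)"
      using assms(6-8) by blast
  next
    fix q
    assume "\<exists>V \<in> compact_opens X. \<exists>t \<in> sect F V. \<exists>y \<in> V.
          germ G X F U s x = germ G X F V t y \<and>
          q = germ G X F (act g ` V) (pre_star G act F V g t) (act g y)"
    then obtain V t y where V: "V \<in> compact_opens X" "t \<in> sect F V" "y \<in> V"
      and eq: "germ G X F U s x = germ G X F V t y"
      and q: "q = germ G X F (act g ` V) (pre_star G act F V g t) (act g y)"
      by blast
    from eq have xy: "x = y" and rel: "((U, s), (V, t)) \<in> germ_rel G X F x"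
      using germ_eq_iff[OF assms(1,3,4,6,8,7) V(1,3,2)] by auto
    then obtain W where W: "W \<in> compact_opens X" "x \<in> W" "W \<subseteq> U" "W \<subseteq> V"
      "pull F W U \<one>\<^bsub>G\<^esub> s = pull F W V \<one>\<^bsub>G\<^esub> t"
      by (auto simp: germ_rel_def)
    have "((act g ` U, pre_star G act F U g s), (act g ` V, pre_star G act F V g t))
            \<in> germ_rel G X F (act g x)"
      using W res[OF W(1) assms(6) W(3) assms(7)] res[OF W(1) V(1) W(4) V(2)]
        im star assms(6-8) V xy by (auto simp: germ_rel_def intro!: bexI[of _ "act g ` W"])
    then show "q = germ G X F (act g ` U) (pre_star G act F U g s) (act g x)"
      unfolding q using germ_eq_iff[OF assms(1,3,4) im[OF assms(6)] _ star[OF assms(6,7)]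
          im[OF V(1)] _ star[OF V(1,2)], of "act g x" "act g y"] xy assms(8) V(3) by auto
  qed
  then show ?thesis
    by (simp add: germ_act_def germ_in_topspace[OF assms(6,8,7)])
qed

lemma sheafify_map_germ:
  assumes "G_space G TG X act" "G_presheaf G TG X act F" "G_presheaf G TG X act F'" "Hausdorff_space X"
    and "\<phi> \<in> presheaf_hom G X act F F'" "U \<in> compact_opens X" "s \<in> sect F U" "x \<in> U"
  shows "sheafify_map G X F F' \<phi> (germ G X F U s x) = germ G X F' U (\<phi> U s) x"
proof -
  have mem: "\<phi> V t \<in> sect F' V" if "V \<in> compact_opens X" "t \<in> sect F V" for V t
    using presheaf_hom_closed[OF assms(5) that] .
  have nat: "\<phi> W (pull F W V \<one>\<^bsub>G\<^esub> t) = pull F' W V \<one>\<^bsub>G\<^esub> (\<phi> V t)"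
    if "W \<in> compact_opens X" "V \<in> compact_opens X" "W \<subseteq> V" "t \<in> sect F V" for W V t
    using presheaf_hom_natural[OF assms(5) that(1,2) one_orbit_hom[OF assms(1) that(1,3)] that(4)] .
  have "(THE q. \<exists>V \<in> compact_opens X. \<exists>t \<in> sect F V. \<exists>y \<in> V.
          germ G X F U s x = germ G X F V t y \<and> q = germ G X F' V (\<phi> V t) y) =
        germ G X F' U (\<phi> U s) x"
  proof (rule the_equality)
    show "\<exists>V \<in> compact_opens X. \<exists>t \<in> sect F V. \<exists>y \<in> V.
          germ G X F U s x = germ G X F V t y \<and> germ G X F' U (\<phi> U s) x = germ G X F' V (\<phi> V t) y"
      using assms(6-8) by blast
  next
    fix q
    assume "\<exists>V \<in> compact_opens X. \<exists>t \<in> sect F V. \<exists>y \<in> V.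
          germ G X F U s x = germ G X F V t y \<and> q = germ G X F' V (\<phi> V t) y"
    then obtain V t y where V: "V \<in> compact_opens X" "t \<in> sect F V" "y \<in> V"
      and eq: "germ G X F U s x = germ G X F V t y" and q: "q = germ G X F' V (\<phi> V t) y"
      by blast
    from eq have xy: "x = y" and rel: "((U, s), (V, t)) \<in> germ_rel G X F x"
      using germ_eq_iff[OF assms(1,2,4,6,8,7) V(1,3,2)] by auto
    then obtain W where W: "W \<in> compact_opens X" "x \<in> W" "W \<subseteq> U" "W \<subseteq> V"
      "pull F W U \<one>\<^bsub>G\<^esub> s = pull F W V \<one>\<^bsub>G\<^esub> t"
      by (auto simp: germ_rel_def)
    have "((U, \<phi> U s), (V, \<phi> V t)) \<in> germ_rel G X F' x"
      using W nat[OF W(1) assms(6) W(3) assms(7)] nat[OF W(1) V(1) W(4) V(2)]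
        mem assms(6-8) V xy by (auto simp: germ_rel_def intro!: bexI[of _ W])
    then show "q = germ G X F' U (\<phi> U s) x"
      unfolding q using germ_eq_iff[OF assms(1,3,4,6,8) mem[OF assms(6,7)] V(1,3) mem[OF V(1,2)]]
        xy by auto
  qed
  then show ?thesis
    by (simp add: sheafify_map_def germ_in_topspace[OF assms(6,8,7)])
qed

end

theory Submission
  imports Defs
begin

text \<open>
  The germ action is continuous because, near \<open>(g, s\<^sub>x)\<close>, the group element only moves within a
  coset of the open subgroup fixing a compact-open neighbourhood of \<open>x\<close> and the section \<open>s\<close> over
  it; dually, sections of a \<open>G\<close>-sheaf over a compact open set have open stabilizers by the tube
  lemma. A morphism of presheaves from \<open>F\<close> to the sections of \<open>E\<close> factors uniquely through
  germs, which gives the adjunction. As the compact open sets are a basis of \<open>X\<close>, every point of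
  \<open>E\<close> lies on a section over one of them and two such sections meeting in a point agree nearby, so
  the counit is a bijective open map, hence an isomorphism. Idempotence and full faithfulness follow.
\<close>

section \<open>Compact open sets and discrete spaces\<close>


text \<open>Points of the sheaf space are equivalence classes, so \<open>germ_act\<close>,
  \<open>sheafify_map\<close> and the lift of a presheaf morphism are definite descriptions over
  representatives. Apart from extensionality they are used only through their values on germs:
  continuity, equality and equivariance of a map out of the sheaf space are all tested on the germ
  sections of the presheaf. Compactness of \<open>U\<close> enters through the tube lemma, which
  turns a condition on all points of \<open>U\<close> into an open condition on the group element.
  This is why presheaves live on the compact open sets, and it gives both the open stabilizer of
  \<open>U\<close> and the open stabilizer of a section over \<open>U\<close>. The canonical map
  from the sheafification of \<open>F\<close> to its second sheafification can be read as the unit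
  at the presheaf of sections, or as the sheafification of the unit of \<open>F\<close>. Both
  readings are induced by one isomorphism \<delta>, the inverse of the counit, which sends
  \<open>s x\<close> to the germ of \<open>s\<close> at \<open>x\<close>. For this reason \<delta>,
  rather than the counit, is carried through the later proofs.\<close>

lemma compact_opens_base:
  assumes "profinite_space X" "openin X V" "x \<in> V"
  obtains W where "W \<in> compact_opens X" "x \<in> W" "W \<subseteq> V"
proof -
  have X: "compact_space X" "Hausdorff_space X" "totally_disconnected_space X"
    using assms(1) by (auto simp: profinite_space_def)
  have x: "x \<in> topspace X"
    using assms(2,3) openin_subset by blast
  \<comment> \<open>In a compact Hausdorff space, two closed sets that no connected set meets
    simultaneously are separated by a clopen set. Total disconnectedness shrinks every connected set
    through \<open>x\<close> to \<open>{x}\<close>, which misses the complement of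
    \<open>V\<close>.\<close>
  have "separated_between X {x} (topspace X - V)"
  proof (rule cut_wire_fence_theorem[OF X(1,2)])
    show "closedin X {x}"
      using X(2) x by (simp add: closedin_Hausdorff_singleton)
    show "closedin X (topspace X - V)"
      using assms(2) by blast
    show "disjnt C {x} \<or> disjnt C (topspace X - V)" if C: "connectedin X C" for C
    proof (rule ccontr)
      assume "\<not> (disjnt C {x} \<or> disjnt C (topspace X - V))"
      then obtain y where "x \<in> C" "y \<in> C" "y \<notin> V"
        by (auto simp: disjnt_iff)
      moreover from this C have "connected_component_of X x y"
        unfolding connected_component_of_def by blast
      ultimately show False
        using X(3) x assms(3) by (auto simp: totally_disconnected_space_def)
    qed
  qed
  then obtain W where W: "closedin X W" "openin X W" "{x} \<subseteq> W" "topspace X - V \<subseteq> topspace X - W"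
    unfolding separated_between by blast
  show ?thesis
  proof (rule that)
    show "W \<in> compact_opens X"
      using W X(1) by (simp add: compact_opens_def closedin_compact_space)
    show "x \<in> W"
      using W by simp
    show "W \<subseteq> V"
      using W closedin_subset by blast
  qed
qed

text \<open>The form in which compactness is used: a condition that is open in a pair and is imposed
  on every second component in \<open>K\<close> is an open condition on the first component.\<close>

lemma openin_tube:
  assumes "openin (prod_topology X Y) W" "compactin Y K"
  shows "openin X {x \<in> topspace X. {x} \<times> K \<subseteq> W}"
proof (subst openin_subopen, intro ballI)
  fix x assume "x \<in> {x \<in> topspace X. {x} \<times> K \<subseteq> W}"
  then obtain U V where "openin X U" "x \<in> U" "K \<subseteq> V" "U \<times> V \<subseteq> W"
    using tube_lemma_right[OF assms, of x] by auto
  then show "\<exists>T. openin X T \<and> x \<in> T \<and> T \<subseteq> {x \<in> topspace X. {x} \<times> K \<subseteq> W}"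
    by (intro exI[of _ U]) (auto dest: openin_subset)
qed

text \<open>The slices over the points \<open>s\<close> are open, so continuity can be tested on
  each of them. For the continuity clause of \<open>G_presheaf\<close> this leaves one orbit map
  \<open>g \<mapsto> g * s\<close> at a time.\<close>

lemma continuous_map_prod_discrete_iff:
  "continuous_map (prod_topology T (discrete_topology S)) Y f \<longleftrightarrow>
     (\<forall>s \<in> S. continuous_map T Y (\<lambda>x. f (x, s)))"
proof
  assume f: "continuous_map (prod_topology T (discrete_topology S)) Y f"
  show "\<forall>s \<in> S. continuous_map T Y (\<lambda>x. f (x, s))"
  proof
    fix s assume "s \<in> S"
    then have "continuous_map T (prod_topology T (discrete_topology S)) (\<lambda>x. (x, s))"
      by (intro continuous_map_pairedI) auto
    from continuous_map_compose[OF this f] show "continuous_map T Y (\<lambda>x. f (x, s))"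
      by (simp add: o_def)
  qed
next
  assume f: "\<forall>s \<in> S. continuous_map T Y (\<lambda>x. f (x, s))"
  show "continuous_map (prod_topology T (discrete_topology S)) Y f"
    unfolding continuous_map_def
  proof (intro conjI allI impI)
    show "f \<in> topspace (prod_topology T (discrete_topology S)) \<rightarrow> topspace Y"
      using f by (auto simp: continuous_map_def)
    fix N assume N: "openin Y N"
    show "openin (prod_topology T (discrete_topology S))
            {p \<in> topspace (prod_topology T (discrete_topology S)). f p \<in> N}"
      unfolding openin_prod_topology_alt
    proof (intro allI impI)
      fix x s
      assume "(x, s) \<in> {p \<in> topspace (prod_topology T (discrete_topology S)). f p \<in> N}"
      then have xs: "x \<in> topspace T" "s \<in> S" "f (x, s) \<in> N"
        by auto
      have "openin T {y \<in> topspace T. f (y, s) \<in> N}"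
        using f xs(2) N openin_continuous_map_preimage by blast
      then show "\<exists>U V. openin T U \<and> openin (discrete_topology S) V \<and> x \<in> U \<and> s \<in> V \<and>
          U \<times> V \<subseteq> {p \<in> topspace (prod_topology T (discrete_topology S)). f p \<in> N}"
        using xs by (intro exI[of _ "{y \<in> topspace T. f (y, s) \<in> N}"] exI[of _ "{s}"]) auto
    qed
  qed
qed

text \<open>Every set is a union of points, so fibres over points suffice. Together with the
  previous lemma, the continuity clause of a presheaf becomes the openness of all sets of group
  elements with \<open>g * s = t\<close>.\<close>

lemma continuous_map_into_discrete_iff:
  "continuous_map T (discrete_topology S) f \<longleftrightarrow>
     f ` topspace T \<subseteq> S \<and> (\<forall>s \<in> S. openin T {x \<in> topspace T. f x = s})"
proof (intro iffI conjI ballI)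
  assume f: "continuous_map T (discrete_topology S) f"
  then show "f ` topspace T \<subseteq> S"
    by (auto simp: continuous_map_def)
  show "openin T {x \<in> topspace T. f x = s}" if "s \<in> S" for s
    using openin_continuous_map_preimage[OF f, of "{s}"] that by simp
next
  assume f: "f ` topspace T \<subseteq> S \<and> (\<forall>s \<in> S. openin T {x \<in> topspace T. f x = s})"
  show "continuous_map T (discrete_topology S) f"
    unfolding continuous_map_def
  proof (intro conjI allI impI)
    fix U assume "openin (discrete_topology S) U"
    then have "openin T (\<Union>s \<in> U. {x \<in> topspace T. f x = s})"
      using f by (intro openin_Union) auto
    moreover have "(\<Union>s \<in> U. {x \<in> topspace T. f x = s}) = {x \<in> topspace T. f x \<in> U}"
      by auto
    ultimately show "openin T {x \<in> topspace T. f x \<in> U}"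
      by simp
  qed (use f in auto)
qed


section \<open>Local homeomorphisms\<close>

lemma local_homeomorphismE:
  assumes "local_homeomorphism E X p" "e \<in> topspace E"
  obtains N g where "openin E N" "e \<in> N" "openin X (p ` N)"
    "homeomorphic_maps (subtopology E N) (subtopology X (p ` N)) p g"
  using assms unfolding local_homeomorphism_def homeomorphic_map_maps by blast

lemma local_homeomorphism_continuous_map:
  assumes "local_homeomorphism E X p"
  shows "continuous_map E X p"
  unfolding continuous_map_def
proof (intro conjI allI impI)
  show "p \<in> topspace E \<rightarrow> topspace X"
  proof
    fix e assume "e \<in> topspace E"
    then obtain N where "e \<in> N" "openin X (p ` N)"
      by (rule local_homeomorphismE[OF assms])
    then show "p e \<in> topspace X"
      using openin_subset by blast
  qed
  fix U assume U: "openin X U"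
  show "openin E {e \<in> topspace E. p e \<in> U}"
  proof (subst openin_subopen, intro ballI)
    fix e assume e: "e \<in> {e \<in> topspace E. p e \<in> U}"
    then obtain N g where N: "openin E N" "e \<in> N"
        "homeomorphic_maps (subtopology E N) (subtopology X (p ` N)) p g"
      using local_homeomorphismE[OF assms, of e] by blast
    have "continuous_map (subtopology E N) X p"
      using N(3) by (simp add: homeomorphic_maps_def continuous_map_in_subtopology)
    from openin_continuous_map_preimage[OF this U]
    have "openin E {e \<in> topspace (subtopology E N). p e \<in> U}"
      using openin_trans_full N(1) by blast
    then show "\<exists>T. openin E T \<and> e \<in> T \<and> T \<subseteq> {e \<in> topspace E. p e \<in> U}"
      using e N(2) by (intro exI conjI) (assumption, auto)
  qed
qed

text \<open>Near a common value the map \<open>p\<close> is injective, so two maps with the same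
  projection that agree at a point agree around it. The lemma yields open images of sections, open
  stabilizers of sections, and equality of germs from equality at a point.\<close>

lemma openin_local_homeomorphism_equalizer:
  assumes "local_homeomorphism E X p" "continuous_map Y E a" "continuous_map Y E b"
    and "\<And>y. y \<in> topspace Y \<Longrightarrow> p (a y) = p (b y)"
  shows "openin Y {y \<in> topspace Y. a y = b y}"
proof (subst openin_subopen, intro ballI)
  fix y assume y: "y \<in> {y \<in> topspace Y. a y = b y}"
  have "a y \<in> topspace E"
    using y assms(2) unfolding continuous_map_def by blast
  then obtain N g where N: "openin E N" "a y \<in> N"
      "homeomorphic_maps (subtopology E N) (subtopology X (p ` N)) p g"
    using local_homeomorphismE[OF assms(1)] by blast
  then have g: "g (p e) = e" if "e \<in> N" for e
    using that openin_subset[OF N(1)] by (auto simp: homeomorphic_maps_def)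
  let ?T = "{y \<in> topspace Y. a y \<in> N} \<inter> {y \<in> topspace Y. b y \<in> N}"
  have "openin Y ?T"
    using openin_continuous_map_preimage[OF assms(2) N(1)]
      openin_continuous_map_preimage[OF assms(3) N(1)] by blast
  moreover have "?T \<subseteq> {y \<in> topspace Y. a y = b y}"
    using assms(4) g by (auto, metis)
  ultimately show "\<exists>T. openin Y T \<and> y \<in> T \<and> T \<subseteq> {y \<in> topspace Y. a y = b y}"
    using y N(2) by (intro exI[of _ ?T]) auto
qed

lemma local_homeomorphism_section:
  assumes "local_homeomorphism E X p" "e \<in> topspace E"
  obtains V s where "openin X V" "p e \<in> V" "continuous_map (subtopology X V) E s"
    "\<And>x. x \<in> V \<Longrightarrow> p (s x) = x" "s (p e) = e"
proof -
  obtain N g where N: "openin E N" "e \<in> N" "openin X (p ` N)"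
      "homeomorphic_maps (subtopology E N) (subtopology X (p ` N)) p g"
    using local_homeomorphismE[OF assms] by blast
  show ?thesis
  proof (rule that[of "p ` N" g])
    show "continuous_map (subtopology X (p ` N)) E g"
      using N(4) by (simp add: homeomorphic_maps_def continuous_map_in_subtopology)
    show "p (g x) = x" if "x \<in> p ` N" for x
      using N(4) that openin_subset[OF N(3)] by (auto simp: homeomorphic_maps_def)
    show "g (p e) = e"
      using N(2,4) openin_subset[OF N(1)] by (auto simp: homeomorphic_maps_def)
  qed (use N in auto)
qed

text \<open>The image of a section consists of the points over \<open>U\<close> at which
  \<open>s \<circ> p\<close> equals the identity. Both are maps over \<open>X\<close>, so the
  previous equalizer lemma applies.\<close>

lemma openin_section_image:
  assumes "local_homeomorphism E X p" "openin X U" "continuous_map (subtopology X U) E s"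
    and "\<And>x. x \<in> U \<Longrightarrow> p (s x) = x"
  shows "openin E (s ` U)"
proof -
  let ?P = "{e \<in> topspace E. p e \<in> U}"
  have p: "continuous_map E X p"
    by (rule local_homeomorphism_continuous_map[OF assms(1)])
  have P: "openin E ?P"
    by (rule openin_continuous_map_preimage[OF p assms(2)])
  have "continuous_map (subtopology E ?P) (subtopology X U) p"
    using p by (auto simp: continuous_map_in_subtopology continuous_map_from_subtopology)
  from continuous_map_compose[OF this assms(3)]
  have "openin (subtopology E ?P) {e \<in> topspace (subtopology E ?P). (s \<circ> p) e = id e}"
    using assms(4)
    by (intro openin_local_homeomorphism_equalizer[OF assms(1)])
      (auto simp: continuous_map_from_subtopology o_def)
  moreover have "{e \<in> topspace (subtopology E ?P). (s \<circ> p) e = id e} = s ` U"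
    using assms(3,4) openin_subset[OF assms(2)]
    by (auto simp: continuous_map_def image_iff Pi_iff) (metis)
  ultimately show ?thesis
    using openin_trans_full P by fastforce
qed


section \<open>Equivariant sheafification over a profinite space\<close>

text \<open>\<open>Bij S\<close> contains only extensional functions, hence the hypothesis on
  extensionality. Bijectivity of \<open>a g\<close> comes from the action of the inverse
  element.\<close>

lemma group_actionI:
  assumes "group G"
    and ext: "\<And>g. g \<in> carrier G \<Longrightarrow> a g \<in> extensional S"
    and closed: "\<And>g x. g \<in> carrier G \<Longrightarrow> x \<in> S \<Longrightarrow> a g x \<in> S"
    and one: "\<And>x. x \<in> S \<Longrightarrow> a \<one>\<^bsub>G\<^esub> x = x"
    and mult: "\<And>g h x. g \<in> carrier G \<Longrightarrow> h \<in> carrier G \<Longrightarrow> x \<in> S \<Longrightarrow>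
      a (g \<otimes>\<^bsub>G\<^esub> h) x = a g (a h x)"
  shows "group_action G S a"
proof -
  interpret group G by (rule assms(1))
  have bij: "a g \<in> Bij S" if "g \<in> carrier G" for g
    unfolding Bij_def
  proof (intro IntI CollectI ext that bij_betw_byWitness[where f' = "a (inv\<^bsub>G\<^esub> g)"])
    show "\<forall>x \<in> S. a (inv\<^bsub>G\<^esub> g) (a g x) = x" "\<forall>x \<in> S. a g (a (inv\<^bsub>G\<^esub> g) x) = x"
      using that one by (simp_all flip: mult)
    show "a g ` S \<subseteq> S" "a (inv\<^bsub>G\<^esub> g) ` S \<subseteq> S"
      using closed that by auto
  qed
  have "a (g \<otimes>\<^bsub>G\<^esub> h) = a g \<otimes>\<^bsub>BijGroup S\<^esub> a h" if "g \<in> carrier G" "h \<in> carrier G" for g h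
    using that bij ext[of "g \<otimes>\<^bsub>G\<^esub> h"] mult
    by (auto simp: BijGroup_def compose_def restrict_def extensional_def)
  then have "group_hom G (BijGroup S) a"
    using bij by (intro group_hom.intro group_hom_axioms.intro homI assms(1) group_BijGroup)
      (auto simp: BijGroup_def)
  then show ?thesis
    by (rule group_action.intro)
qed

lemma act_mult:
  assumes "G_space G TG X act" "g \<in> carrier G" "h \<in> carrier G" "x \<in> topspace X"
  shows "act (g \<otimes>\<^bsub>G\<^esub> h) x = act g (act h x)"
  using assms group_action.composition_rule unfolding G_space_def by metis

lemma continuous_map_act:
  assumes "G_space G TG X act" "g \<in> topspace TG"
  shows "continuous_map X X (act g)"
proof -
  have "continuous_map X (prod_topology TG X) (\<lambda>x. (g, x))"
    using assms(2) by (intro continuous_map_pairedI) auto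
  from continuous_map_compose[OF this] assms(1) show ?thesis
    unfolding G_space_def by (fastforce simp: o_def)
qed

lemma presheaf_hom_ext:
  assumes "\<phi> \<in> presheaf_hom G X act F F'" "\<psi> \<in> presheaf_hom G X act F F'"
    and "\<And>U s. U \<in> compact_opens X \<Longrightarrow> s \<in> sect F U \<Longrightarrow> \<phi> U s = \<psi> U s"
  shows "\<phi> = \<psi>"
proof (rule PiE_ext)
  show \<phi>: "\<phi> \<in> (\<Pi>\<^sub>E U \<in> compact_opens X. sect F U \<rightarrow>\<^sub>E sect F' U)"
    using assms(1) by (simp add: presheaf_hom_def)
  show \<psi>: "\<psi> \<in> (\<Pi>\<^sub>E U \<in> compact_opens X. sect F U \<rightarrow>\<^sub>E sect F' U)"
    using assms(2) by (simp add: presheaf_hom_def)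
  show "\<phi> U = \<psi> U" if "U \<in> compact_opens X" for U
    using PiE_mem[OF \<phi> that] PiE_mem[OF \<psi> that] by (rule PiE_ext) (rule assms(3)[OF that])
qed

lemma presheaf_comp_apply:
  "U \<in> compact_opens X \<Longrightarrow> s \<in> sect F U \<Longrightarrow> presheaf_comp X F \<psi> \<phi> U s = \<psi> U (\<phi> U s)"
  by (simp add: presheaf_comp_def compose_def)

lemma sheaf_comp_apply: "e \<in> topspace (total E) \<Longrightarrow> sheaf_comp E f' f e = f' (f e)"
  by (simp add: sheaf_comp_def compose_def)

locale profinite_G_space =
  fixes G :: "('g, 'm) monoid_scheme" (structure) and TG :: "'g topology"
    and X :: "'x topology" and act :: "'g \<Rightarrow> 'x \<Rightarrow> 'x"
  assumes topological_group: "topological_group G TG"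
    and profinite_space: "profinite_space X"
    and G_space: "G_space G TG X act"
begin

sublocale group G
  using G_space by (rule G_space_group)

lemma topspace_TG [simp]: "topspace TG = carrier G"
  using topological_group by (simp add: topological_group_def)

lemma Hausdorff_space: "Hausdorff_space X"
  using profinite_space by (simp add: profinite_space_def)

lemma openin_compact_opens: "U \<in> compact_opens X \<Longrightarrow> openin X U"
  by (simp add: compact_opens_def)

lemma compact_opens_subset: "U \<in> compact_opens X \<Longrightarrow> U \<subseteq> topspace X"
  by (simp add: compact_opens_def openin_subset)

lemma in_compact_opens: "U \<in> compact_opens X \<Longrightarrow> x \<in> U \<Longrightarrow> x \<in> topspace X"
  using compact_opens_subset by blast

lemma topspace_subtopology_compact_opens [simp]:
  "U \<in> compact_opens X \<Longrightarrow> topspace (subtopology X U) = U"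
  using compact_opens_subset by auto

lemmas compact_open_base = compact_opens_base[OF profinite_space]

lemma act_image: "g \<in> carrier G \<Longrightarrow> U \<in> compact_opens X \<Longrightarrow> act g ` U \<in> compact_opens X"
  by (rule act_compact_opens[OF G_space topspace_TG])

lemma act_inv_image:
  assumes "g \<in> carrier G" "U \<in> compact_opens X"
  shows "act (inv g) ` act g ` U = U" and "act g ` act (inv g) ` U = U"
  using assms in_compact_opens by (force simp: act_inv[OF G_space] act_inv'[OF G_space] image_iff)+

lemma act_mult_image:
  "g \<in> carrier G \<Longrightarrow> h \<in> carrier G \<Longrightarrow> U \<in> compact_opens X \<Longrightarrow>
    act (g \<otimes> h) ` U = act g ` act h ` U"
  using in_compact_opens by (force simp: act_mult[OF G_space] image_iff)

lemma act_one_image: "U \<in> compact_opens X \<Longrightarrow> act \<one> ` U = U"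
  using in_compact_opens by (force simp: act_one[OF G_space] image_iff)

lemma inv_orbit_hom:
  "g \<in> carrier G \<Longrightarrow> U \<in> compact_opens X \<Longrightarrow> inv g \<in> orbit_hom G act (act g ` U) U"
  by (rule orbit_homI) (simp_all add: act_inv_image)

lemma continuous_map_mult_left:
  "g \<in> carrier G \<Longrightarrow> continuous_map TG TG (\<lambda>h. g \<otimes> h)"
proof -
  assume g: "g \<in> carrier G"
  then have "continuous_map TG (prod_topology TG TG) (\<lambda>h. (g, h))"
    by (intro continuous_map_pairedI) auto
  from continuous_map_compose[OF this] topological_group show ?thesis
    unfolding topological_group_def by (fastforce simp: o_def)
qed

text \<open>The tube lemma only makes the inclusion of \<open>gU\<close> in \<open>U\<close> an open
  condition. Equality is this inclusion for both \<open>g\<close> and \<open>inv g\<close>, so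
  continuity of inversion completes the argument.\<close>

lemma openin_stabilizer:
  assumes "U \<in> compact_opens X"
  shows "openin TG (stabilizer G (\<lambda>g. (`) (act g)) U)"
proof -
  let ?P = "{p \<in> topspace (prod_topology TG X). (\<lambda>(g, x). act g x) p \<in> U}"
  let ?O = "{g \<in> topspace TG. {g} \<times> U \<subseteq> ?P}"
  have "openin (prod_topology TG X) ?P"
    using G_space assms unfolding G_space_def
    by (intro openin_continuous_map_preimage) (auto simp: compact_opens_def)
  then have O: "openin TG ?O"
    using assms by (intro openin_tube) (auto simp: compact_opens_def)
  have O_eq: "?O = {g \<in> carrier G. act g ` U \<subseteq> U}"
    using compact_opens_subset[OF assms] by auto
  have "continuous_map TG TG (\<lambda>g. inv g)"
    using topological_group by (simp add: topological_group_def)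
  from openin_continuous_map_preimage[OF this O] O
  have "openin TG (?O \<inter> {g \<in> topspace TG. inv g \<in> ?O})"
    by blast
  moreover have "g \<in> ?O \<inter> {g \<in> topspace TG. inv g \<in> ?O} \<longleftrightarrow> g \<in> stabilizer G (\<lambda>g. (`) (act g)) U" for g
  proof (cases "g \<in> carrier G")
    case True
    then have "act g ` U = U \<longleftrightarrow> act g ` U \<subseteq> U \<and> act (inv g) ` U \<subseteq> U"
      using act_inv_image[OF True assms] image_mono[of "act (inv g) ` U" U "act g"]
        image_mono[of U "act g ` U" "act (inv g)"] by auto
    then show ?thesis
      unfolding O_eq unfolding stabilizer_def topspace_TG Int_iff mem_Collect_eq
      using True inv_closed[OF True] by argo
  qed (simp add: stabilizer_def)
  then have "?O \<inter> {g \<in> topspace TG. inv g \<in> ?O} = stabilizer G (\<lambda>g. (`) (act g)) U"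
    by blast
  ultimately show ?thesis
    by argo
qed


subsection \<open>The forgetful functor\<close>

lemma
  assumes "G_sheaf G TG X act E"
  shows G_sheaf_space: "G_space G TG (total E) (gact E)"
    and G_sheaf_local_homeomorphism: "local_homeomorphism (total E) X (proj E)"
    and proj_gact: "g \<in> carrier G \<Longrightarrow> e \<in> topspace (total E) \<Longrightarrow> proj E (gact E g e) = act g (proj E e)"
  using assms by (auto simp: G_sheaf_def)

lemma sect_forget [simp]: "sect (forget G X act E) = sections X E"
  by (simp add: forget_def)

lemma sections_continuous_map:
  "s \<in> sections X E U \<Longrightarrow> continuous_map (subtopology X U) (total E) s"
  by (simp add: sections_def)

lemma sections_closed:
  "U \<in> compact_opens X \<Longrightarrow> s \<in> sections X E U \<Longrightarrow> x \<in> U \<Longrightarrow> s x \<in> topspace (total E)"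
  using sections_continuous_map[of s E U] in_compact_opens by (auto simp: continuous_map_def)

lemma proj_section: "s \<in> sections X E U \<Longrightarrow> x \<in> U \<Longrightarrow> proj E (s x) = x"
  by (simp add: sections_def)

lemma sections_ext:
  "s \<in> sections X E U \<Longrightarrow> t \<in> sections X E U \<Longrightarrow> (\<And>x. x \<in> U \<Longrightarrow> s x = t x) \<Longrightarrow> s = t"
  unfolding sections_def by (blast intro: extensionalityI)

lemma orbit_hom_image: "g \<in> orbit_hom G act U V \<Longrightarrow> x \<in> U \<Longrightarrow> act g x \<in> V"
  by (auto simp: orbit_hom_def)

lemma orbit_hom_carrier: "g \<in> orbit_hom G act U V \<Longrightarrow> g \<in> carrier G"
  by (simp add: orbit_hom_def)

lemma pull_forget:
  assumes "U \<in> compact_opens X" "g \<in> orbit_hom G act U V"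
  shows "pull (forget G X act E) U V g s = (\<lambda>x \<in> U. gact E (inv g) (s (act g x)))"
proof -
  \<comment> \<open>\<open>section_star\<close> has meaningful values only on the translate of
    \<open>V\<close> by \<open>inv g\<close>. As \<open>U\<close> lies in that translate, its
    default value elsewhere is never read.\<close>
  have "x \<in> act (inv g) ` V" if "x \<in> U" for x
    using assms orbit_hom_image[OF assms(2) that] orbit_hom_carrier[OF assms(2)]
      in_compact_opens[OF assms(1) that] act_inv[OF G_space] by (metis imageI)
  then show ?thesis
    using orbit_hom_carrier[OF assms(2)] by (auto simp: forget_def section_star_def)
qed

lemma pull_forget_one:
  assumes "G_sheaf G TG X act E" "U \<in> compact_opens X" "V \<in> compact_opens X" "U \<subseteq> V"
    "s \<in> sections X E V"
  shows "pull (forget G X act E) U V \<one> s = restrict s U"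
proof -
  have "gact E \<one> (s (act \<one> x)) = s x" if "x \<in> U" for x
    using assms that in_compact_opens[OF assms(2) that] sections_closed[OF assms(3,5)]
    by (auto simp: act_one[OF G_space] act_one[OF G_sheaf_space[OF assms(1)]])
  then show ?thesis
    using pull_forget[OF assms(2) one_orbit_hom[OF G_space assms(2,4)], of E s] by auto
qed

lemma pre_star_forget:
  assumes "U \<in> compact_opens X" "g \<in> carrier G"
  shows "pre_star G act (forget G X act E) U g s =
    (\<lambda>x \<in> act g ` U. gact E g (s (act (inv g) x)))"
  unfolding pre_star_def
  using pull_forget[OF act_image[OF assms(2,1)] inv_orbit_hom[OF assms(2,1)]] assms by simp

lemma pull_forget_in_sections:
  assumes E: "G_sheaf G TG X act E" and U: "U \<in> compact_opens X" "V \<in> compact_opens X"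
    and g: "g \<in> orbit_hom G act U V" and s: "s \<in> sections X E V"
  shows "pull (forget G X act E) U V g s \<in> sections X E U"
proof -
  note gc = orbit_hom_carrier[OF g]
  have "continuous_map (subtopology X U) (subtopology X V) (act g)"
    using continuous_map_act[OF G_space, of g] gc orbit_hom_image[OF g]
    by (auto simp: continuous_map_in_subtopology continuous_map_from_subtopology)
  from continuous_map_compose[OF continuous_map_compose[OF this sections_continuous_map[OF s]]
      continuous_map_act[OF G_sheaf_space[OF E], of "inv g"]] gc
  have "continuous_map (subtopology X U) (total E) (gact E (inv g) \<circ> (s \<circ> act g))"
    by simp
  then have "continuous_map (subtopology X U) (total E) (\<lambda>x \<in> U. gact E (inv g) (s (act g x)))"
    by (rule continuous_map_eq) (use U in auto)
  then show ?thesis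
    unfolding pull_forget[OF U(1) g] sections_def
    using proj_gact[OF E] sections_closed[OF U(2) s] orbit_hom_image[OF g] gc
      proj_section[OF s] in_compact_opens[OF U(1)] act_inv[OF G_space]
    by auto
qed

lemma forget_presheaf:
  assumes E: "G_sheaf G TG X act E"
  shows "G_presheaf G TG X act (forget G X act E)"
  unfolding G_presheaf_def
proof (intro conjI ballI)
  fix U V g
  assume "U \<in> compact_opens X" "V \<in> compact_opens X" "g \<in> orbit_hom G act U V"
  then show "pull (forget G X act E) U V g \<in> sect (forget G X act E) V \<rightarrow> sect (forget G X act E) U"
    using pull_forget_in_sections[OF E] by auto
next
  fix U s assume "U \<in> compact_opens X" "s \<in> sect (forget G X act E) U"
  then show "pull (forget G X act E) U U \<one> s = s"
    using pull_forget_one[OF E, of U U s] by (auto simp: sections_def extensional_restrict)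
next
  fix U V W g h s
  assume U: "U \<in> compact_opens X" "V \<in> compact_opens X" "W \<in> compact_opens X"
    and g: "g \<in> orbit_hom G act U V" and h: "h \<in> orbit_hom G act V W"
    and s: "s \<in> sect (forget G X act E) W"
  have c: "g \<in> carrier G" "h \<in> carrier G"
    using g h by (auto dest: orbit_hom_carrier)
  have hg: "h \<otimes> g \<in> orbit_hom G act U W"
    using c orbit_hom_image[OF g] orbit_hom_image[OF h] in_compact_opens[OF U(1)]
    by (intro orbit_homI) (auto simp: act_mult[OF G_space])
  have "gact E (inv (h \<otimes> g)) (s (act (h \<otimes> g) x)) = gact E (inv g) (gact E (inv h) (s (act h (act g x))))"
    if "x \<in> U" for x
    using that c s sections_closed[OF U(3), of s E "act h (act g x)"] orbit_hom_image[OF g]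
      orbit_hom_image[OF h] in_compact_opens[OF U(1)]
    by (simp add: act_mult[OF G_space] act_mult[OF G_sheaf_space[OF E]] inv_mult_group)
  then show "pull (forget G X act E) U W (h \<otimes> g) s =
      pull (forget G X act E) U V g (pull (forget G X act E) V W h s)"
    using orbit_hom_image[OF g]
    by (auto simp: pull_forget[OF U(1) hg] pull_forget[OF U(1) g] pull_forget[OF U(2) h])
next
  fix U assume U: "U \<in> compact_opens X"
  let ?S = "stabilizer G (\<lambda>g. (`) (act g)) U" and ?star = "pre_star G act (forget G X act E) U"
  have S: "g \<in> carrier G" "act g ` U = U" if "g \<in> ?S" for g
    using that by (auto simp: stabilizer_def)
  have actU: "act g x \<in> U" if "g \<in> ?S" "x \<in> U" for g x
    using S(2)[OF that(1)] that(2) by blast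
  have top: "topspace (subtopology TG ?S) = ?S"
    by (auto simp: stabilizer_def)
  have star: "?star g s \<in> sections X E U" if "g \<in> ?S" "s \<in> sections X E U" for g s
    using pull_forget_in_sections[OF E _ U inv_orbit_hom[OF _ U] that(2), of g] U S[OF that(1)]
    by (simp add: pre_star_def)
  \<comment> \<open>By the two criteria for discrete spaces, this is all that continuity of the
    action on sections amounts to.\<close>
  have "openin (subtopology TG ?S) {g \<in> ?S. ?star g s = t}"
    if s: "s \<in> sections X E U" and t: "t \<in> sections X E U" for s t
  proof -
    let ?P = "prod_topology (subtopology TG ?S) (subtopology X U)"
    \<comment> \<open>The equation \<open>g * s = t\<close> is read at the point \<open>gx\<close>,
      where it says that \<open>g\<close> applied to \<open>s x\<close> is \<open>t (gx)\<close>.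
      Both sides are continuous in \<open>(g, x)\<close> and lie over \<open>gx\<close>, so the
      equalizer is open and the tube lemma can be applied along \<open>U\<close>.\<close>
    let ?Q = "{p \<in> topspace ?P. (\<lambda>(g, x). gact E g (s x)) p = (\<lambda>(g, x). t (act g x)) p}"
    have fst: "continuous_map ?P TG fst" and snd: "continuous_map ?P X snd"
      using continuous_map_fst continuous_map_snd continuous_map_into_fulltopology by blast+
    have "continuous_map ?P (prod_topology TG (total E)) (\<lambda>(g, x). (g, s x))"
      using fst continuous_map_compose[OF continuous_map_snd sections_continuous_map[OF s]]
      by (simp add: case_prod_unfold continuous_map_pairwise o_def)
    from continuous_map_compose[OF this] G_sheaf_space[OF E]
    have 1: "continuous_map ?P (total E) (\<lambda>(g, x). gact E g (s x))"
      unfolding G_space_def by (fastforce simp: o_def case_prod_unfold)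
    have "continuous_map ?P (prod_topology TG X) (\<lambda>(g, x). (g, x))"
      using fst snd by (simp add: case_prod_unfold continuous_map_pairwise o_def)
    from continuous_map_compose[OF this] G_space
    have "continuous_map ?P X (\<lambda>(g, x). act g x)"
      unfolding G_space_def by (fastforce simp: o_def case_prod_unfold)
    then have "continuous_map ?P (subtopology X U) (\<lambda>(g, x). act g x)"
      using actU U by (auto simp: continuous_map_in_subtopology)
    from continuous_map_compose[OF this sections_continuous_map[OF t]]
    have 2: "continuous_map ?P (total E) (\<lambda>(g, x). t (act g x))"
      by (simp add: o_def case_prod_unfold)
    have "openin ?P ?Q"
    proof (rule openin_local_homeomorphism_equalizer[OF G_sheaf_local_homeomorphism[OF E] 1 2])
      fix p assume p: "p \<in> topspace ?P"
      then have "act (fst p) (snd p) \<in> U"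
        using actU U by auto
      then show "proj E ((\<lambda>(g, x). gact E g (s x)) p) = proj E ((\<lambda>(g, x). t (act g x)) p)"
        using p S(1) U proj_gact[OF E] sections_closed[OF U s] proj_section[OF s] proj_section[OF t]
        by (auto simp: case_prod_unfold)
    qed
    moreover have "compactin (subtopology X U) U"
      using U by (simp add: compact_opens_def compactin_subtopology)
    ultimately have op: "openin (subtopology TG ?S) {g \<in> topspace (subtopology TG ?S). {g} \<times> U \<subseteq> ?Q}"
      by (rule openin_tube)
    have "{g} \<times> U \<subseteq> ?Q \<longleftrightarrow> ?star g s = t" if g: "g \<in> ?S" for g
    proof -
      have "(g, x) \<in> ?Q \<longleftrightarrow> gact E g (s x) = t (act g x)" if "x \<in> U" for x
        using g that top in_compact_opens[OF U that] by simp
      then have "{g} \<times> U \<subseteq> ?Q \<longleftrightarrow> (\<forall>x \<in> U. gact E g (s x) = t (act g x))"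
        by blast
      also have "\<dots> \<longleftrightarrow> (\<forall>x \<in> U. ?star g s (act g x) = t (act g x))"
        using U S[OF g] in_compact_opens[OF U]
        by (auto simp: pre_star_forget act_inv[OF G_space])
      \<comment> \<open>Since \<open>g\<close> stabilizes \<open>U\<close>, the points
        \<open>gx\<close> with \<open>x\<close> in \<open>U\<close> exhaust
        \<open>U\<close>.\<close>
      also have "\<dots> \<longleftrightarrow> (\<forall>x \<in> U. ?star g s x = t x)"
        using S(2)[OF g] by (metis (no_types, lifting) image_iff)
      also have "\<dots> \<longleftrightarrow> ?star g s = t"
        using sections_ext[OF star[OF g s] t] by blast
      finally show ?thesis .
    qed
    then have "{g \<in> topspace (subtopology TG ?S). {g} \<times> U \<subseteq> ?Q} = {g \<in> ?S. ?star g s = t}"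
      unfolding top by blast
    with op show ?thesis
      by argo
  qed
  then show "continuous_map
          (prod_topology (subtopology TG ?S) (discrete_topology (sect (forget G X act E) U)))
          (discrete_topology (sect (forget G X act E) U))
          (\<lambda>(g, s). ?star g s)"
    unfolding continuous_map_prod_discrete_iff unfolding continuous_map_into_discrete_iff top
    using star by (auto simp del: topspace_subtopology)
qed

section \<open>The forgetful functor on morphisms\<close>

lemma sheaf_hom_continuous_map:
  "f \<in> sheaf_hom G E E' \<Longrightarrow> continuous_map (total E) (total E') f"
  by (simp add: sheaf_hom_def)

lemma sheaf_hom_proj:
  "f \<in> sheaf_hom G E E' \<Longrightarrow> e \<in> topspace (total E) \<Longrightarrow> proj E' (f e) = proj E e"
  by (simp add: sheaf_hom_def)

lemma sheaf_hom_gact: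
  "f \<in> sheaf_hom G E E' \<Longrightarrow> g \<in> carrier G \<Longrightarrow> e \<in> topspace (total E) \<Longrightarrow>
    f (gact E g e) = gact E' g (f e)"
  by (simp add: sheaf_hom_def)

lemma sheaf_hom_ext:
  "f \<in> sheaf_hom G E E' \<Longrightarrow> f' \<in> sheaf_hom G E E'' \<Longrightarrow>
    (\<And>e. e \<in> topspace (total E) \<Longrightarrow> f e = f' e) \<Longrightarrow> f = f'"
  unfolding sheaf_hom_def by (blast intro: extensionalityI)

lemma compose_section:
  assumes "f \<in> sheaf_hom G E E'" "U \<in> compact_opens X" "s \<in> sections X E U"
  shows "compose U f s \<in> sections X E' U"
proof -
  have "continuous_map (subtopology X U) (total E') (f \<circ> s)"
    by (rule continuous_map_compose[OF sections_continuous_map[OF assms(3)]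
          sheaf_hom_continuous_map[OF assms(1)]])
  then have "continuous_map (subtopology X U) (total E') (compose U f s)"
    by (rule continuous_map_eq) (use assms in \<open>auto simp: compose_def\<close>)
  then show ?thesis
    using sheaf_hom_proj[OF assms(1)] sections_closed[OF assms(2,3)] proj_section[OF assms(3)]
    by (auto simp: sections_def compose_def)
qed

lemma forget_map_eq:
  "U \<in> compact_opens X \<Longrightarrow> s \<in> sections X E U \<Longrightarrow> forget_map X E f U s = compose U f s"
  by (simp add: forget_map_def)

lemma forget_map_in_hom:
  assumes E: "G_sheaf G TG X act E" and f: "f \<in> sheaf_hom G E E'"
  shows "forget_map X E f \<in> presheaf_hom G X act (forget G X act E) (forget G X act E')"
proof (rule presheaf_homI)
  fix U V g s
  assume U: "U \<in> compact_opens X" "V \<in> compact_opens X" and g: "g \<in> orbit_hom G act U V"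
    and s: "s \<in> sect (forget G X act E) V"
  then have "compose U f (pull (forget G X act E) U V g s) =
      pull (forget G X act E') U V g (compose V f s)"
    using orbit_hom_carrier[OF g] orbit_hom_image[OF g] sections_closed[OF U(2), of s E] sheaf_hom_gact[OF f]
    by (auto simp: compose_def pull_forget[OF U(1) g] intro!: restrict_ext)
  then show "forget_map X E f U (pull (forget G X act E) U V g s) =
      pull (forget G X act E') U V g (forget_map X E f V s)"
    using U g s pull_forget_in_sections[OF E] by (simp add: forget_map_eq)
qed (use compose_section[OF f] in \<open>auto simp: forget_map_def\<close>)

lemma forget_map_id: "forget_map X E (sheaf_id E) = presheaf_id X (forget G X act E)"
proof -
  have "compose U (sheaf_id E) s = s" if "U \<in> compact_opens X" "s \<in> sections X E U" for U s
    using that sections_closed[OF that] by (auto simp: compose_def sheaf_id_def sections_def extensional_def)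
  then show ?thesis
    by (fastforce simp: forget_map_def presheaf_id_def intro!: restrict_ext)
qed

lemma forget_map_comp:
  assumes f: "f \<in> sheaf_hom G E E'"
  shows "forget_map X E (sheaf_comp E f' f) =
    presheaf_comp X (forget G X act E) (forget_map X E' f') (forget_map X E f)"
proof -
  have "compose U (sheaf_comp E f' f) s = compose U f' (compose U f s)"
    if "U \<in> compact_opens X" "s \<in> sections X E U" for U s
    using sections_closed[OF that] by (auto simp: compose_def sheaf_comp_def)
  then show ?thesis
    using compose_section[OF f]
    by (fastforce simp: forget_map_def presheaf_comp_def compose_def[of "sections X E _"]
        intro!: restrict_ext)
qed


subsection \<open>The sheaf space\<close>

lemma compact_opens_Int: "U \<in> compact_opens X \<Longrightarrow> V \<in> compact_opens X \<Longrightarrow> U \<inter> V \<in> compact_opens X"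
  using Hausdorff_space unfolding compact_opens_def
  by (auto intro: closed_Int_compactin compactin_imp_closedin)

lemma restrict_closed:
  "G_presheaf G TG X act F \<Longrightarrow> W \<in> compact_opens X \<Longrightarrow> U \<in> compact_opens X \<Longrightarrow> W \<subseteq> U \<Longrightarrow>
    s \<in> sect F U \<Longrightarrow> pull F W U \<one> s \<in> sect F W"
  using pull_closed one_orbit_hom[OF G_space] by metis

lemma pull_id:
  "G_presheaf G TG X act F \<Longrightarrow> U \<in> compact_opens X \<Longrightarrow> s \<in> sect F U \<Longrightarrow> pull F U U \<one> s = s"
  unfolding G_presheaf_def by blast

lemma fst_germ [simp]: "fst (germ G X F U s x) = x"
  by (simp add: germ_def)

lemma germ_eqD:
  assumes "G_presheaf G TG X act F"
    and "U \<in> compact_opens X" "s \<in> sect F U" "x \<in> U"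
    and "V \<in> compact_opens X" "t \<in> sect F V" "y \<in> V"
    and "germ G X F U s x = germ G X F V t y"
  obtains W where "y = x" "W \<in> compact_opens X" "x \<in> W" "W \<subseteq> U" "W \<subseteq> V"
    "pull F W U \<one> s = pull F W V \<one> t"
  using germ_eq_iff[OF G_space assms(1) Hausdorff_space assms(2,4,3,5,7,6)] assms(8)
  by (auto simp: germ_rel_def)

lemma germ_eqI:
  assumes "G_presheaf G TG X act F"
    and "U \<in> compact_opens X" "s \<in> sect F U"
    and "V \<in> compact_opens X" "t \<in> sect F V"
    and "W \<in> compact_opens X" "x \<in> W" "W \<subseteq> U" "W \<subseteq> V"
    and "pull F W U \<one> s = pull F W V \<one> t"
  shows "germ G X F U s x = germ G X F V t x"
proof -
  have "x \<in> U" "x \<in> V"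
    using assms(7-9) by auto
  then have "germ G X F U s x = germ G X F V t x \<longleftrightarrow> x = x \<and> ((U, s), (V, t)) \<in> germ_rel G X F x"
    by (intro germ_eq_iff[OF G_space assms(1) Hausdorff_space] assms)
  then show ?thesis
    using assms \<open>x \<in> U\<close> \<open>x \<in> V\<close> by (auto simp: germ_rel_def)
qed

lemma germ_restrict:
  assumes "G_presheaf G TG X act F" "W \<in> compact_opens X" "U \<in> compact_opens X" "W \<subseteq> U"
    "s \<in> sect F U" "x \<in> W"
  shows "germ G X F W (pull F W U \<one> s) x = germ G X F U s x"
  using assms restrict_closed[OF assms(1-5)] pull_id[OF assms(1,2) restrict_closed[OF assms(1-5)]]
  by (intro germ_eqI[OF assms(1) _ _ _ _ assms(2)]) auto

section \<open>Basic open sets and continuity on the sheaf space\<close>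

lemma sheaf_space_cases:
  assumes "p \<in> topspace (sheaf_space G X F)"
  obtains U s x where "U \<in> compact_opens X" "s \<in> sect F U" "x \<in> U" "p = germ G X F U s x"
  using assms unfolding sheaf_space_def topology_generated_by_topspace by blast

lemmas germ_in_space = germ_in_topspace[where G = G and X = X]

lemma openin_germ_image:
  "U \<in> compact_opens X \<Longrightarrow> s \<in> sect F U \<Longrightarrow> openin (sheaf_space G X F) (germ G X F U s ` U)"
  unfolding sheaf_space_def by (rule topology_generated_by_Basis) blast

text \<open>The topology is generated by the germ images as a subbasis; this shows that they form a
  basis. A point in two germ images comes from sections that agree on some compact open
  \<open>W\<close>, and the germ image of their common restriction to \<open>W\<close> lies in
  both.\<close>

lemma openin_sheaf_spaceE:
  assumes "G_presheaf G TG X act F" "openin (sheaf_space G X F) N" "p \<in> N"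
  obtains U s where "U \<in> compact_opens X" "s \<in> sect F U" "p \<in> germ G X F U s ` U"
    "germ G X F U s ` U \<subseteq> N"
proof -
  let ?B = "{germ G X F U s ` U | U s. U \<in> compact_opens X \<and> s \<in> sect F U}"
  have "generate_topology_on ?B N"
    using assms(2) by (simp add: sheaf_space_def openin_topology_generated_by_iff)
  then have "\<forall>p \<in> N. \<exists>U s. U \<in> compact_opens X \<and> s \<in> sect F U \<and> p \<in> germ G X F U s ` U \<and>
      germ G X F U s ` U \<subseteq> N"
  proof induction
    case (Int a b)
    show ?case
    proof
      fix p assume p: "p \<in> a \<inter> b"
      obtain U s where U: "U \<in> compact_opens X" "s \<in> sect F U" "p \<in> germ G X F U s ` U"
          "germ G X F U s ` U \<subseteq> a"
        using Int.IH(1) p by blast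
      obtain V t where V: "V \<in> compact_opens X" "t \<in> sect F V" "p \<in> germ G X F V t ` V"
          "germ G X F V t ` V \<subseteq> b"
        using Int.IH(2) p by blast
      obtain x y where x: "x \<in> U" "p = germ G X F U s x" and y: "y \<in> V" "p = germ G X F V t y"
        using U(3) V(3) by blast
      have "germ G X F U s x = germ G X F V t y"
        using x(2) y(2) by simp
      then obtain W where W: "y = x" "W \<in> compact_opens X" "x \<in> W" "W \<subseteq> U" "W \<subseteq> V"
          "pull F W U \<one> s = pull F W V \<one> t"
        by (rule germ_eqD[OF assms(1) U(1,2) x(1) V(1,2) y(1)])
      let ?r = "pull F W U \<one> s"
      have eq: "germ G X F W ?r z = germ G X F U s z" "germ G X F W ?r z = germ G X F V t z" if "z \<in> W" for z
        using germ_restrict[OF assms(1) W(2) U(1) W(4) U(2) that]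
          germ_restrict[OF assms(1) W(2) V(1) W(5) V(2) that] W(6) by simp_all
      have "p \<in> germ G X F W ?r ` W"
        unfolding x(2) eq(1)[OF W(3), symmetric] using W(3) by (rule imageI)
      moreover have "germ G X F W ?r ` W \<subseteq> a"
        using subsetD[OF W(4)] subsetD[OF U(4) imageI] by (intro image_subsetI) (simp only: eq(1))
      moreover have "germ G X F W ?r ` W \<subseteq> b"
        using subsetD[OF W(5)] subsetD[OF V(4) imageI] by (intro image_subsetI) (simp only: eq(2))
      ultimately show "\<exists>U s. U \<in> compact_opens X \<and> s \<in> sect F U \<and> p \<in> germ G X F U s ` U \<and>
          germ G X F U s ` U \<subseteq> a \<inter> b"
        by (intro exI conjI Int_greatest) (rule W(2), rule restrict_closed[OF assms(1) W(2) U(1) W(4) U(2)])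
    qed
  next
    case (UN K)
    show ?case
    proof
      fix p assume "p \<in> \<Union>K"
      then obtain k where k: "k \<in> K" "p \<in> k"
        by (rule UnionE)
      from UN.IH[OF k(1)] k(2) obtain U s where U: "U \<in> compact_opens X" "s \<in> sect F U"
          "p \<in> germ G X F U s ` U" "germ G X F U s ` U \<subseteq> k"
        by blast
      then show "\<exists>U s. U \<in> compact_opens X \<and> s \<in> sect F U \<and> p \<in> germ G X F U s ` U \<and>
          germ G X F U s ` U \<subseteq> \<Union>K"
        using order_trans[OF U(4) Union_upper[OF k(1)]] by (intro exI conjI)
    qed
  next
    case (Basis S)
    then obtain U s where U: "S = germ G X F U s ` U" "U \<in> compact_opens X" "s \<in> sect F U"
      by (elim CollectE exE conjE)
    show ?case
      unfolding U(1) using U(2,3) subset_refl by (intro ballI exI conjI)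
  qed simp
  from bspec[OF this assms(3)] show ?thesis
    by (elim exE conjE) (rule that)
qed

text \<open>A neighbourhood of a germ of \<open>s\<close> contains the germ image of some
  \<open>t\<close> through that germ. The two sections then agree on a compact open neighbourhood of
  the base point, where the germs of \<open>s\<close> are germs of \<open>t\<close>.\<close>

lemma continuous_map_germ:
  assumes "G_presheaf G TG X act F" "U \<in> compact_opens X" "s \<in> sect F U"
  shows "continuous_map (subtopology X U) (sheaf_space G X F) (germ G X F U s)"
  unfolding continuous_map_def
proof (intro conjI allI impI)
  show "germ G X F U s \<in> topspace (subtopology X U) \<rightarrow> topspace (sheaf_space G X F)"
    using germ_in_space[OF assms(2) _ assms(3)] by auto
  fix N assume N: "openin (sheaf_space G X F) N"
  show "openin (subtopology X U) {x \<in> topspace (subtopology X U). germ G X F U s x \<in> N}"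
  proof (subst openin_subopen, intro ballI)
    fix x assume "x \<in> {x \<in> topspace (subtopology X U). germ G X F U s x \<in> N}"
    then have x: "x \<in> U" "germ G X F U s x \<in> N"
      by auto
    obtain V t where Vt: "V \<in> compact_opens X" "t \<in> sect F V"
        "germ G X F U s x \<in> germ G X F V t ` V" "germ G X F V t ` V \<subseteq> N"
      by (rule openin_sheaf_spaceE[OF assms(1) N x(2)])
    from Vt(3) obtain y where "germ G X F U s x = germ G X F V t y" "y \<in> V"
      by (rule imageE)
    note V = Vt(1,2) this(2,1) Vt(4)
    obtain W where W: "W \<in> compact_opens X" "x \<in> W" "W \<subseteq> U" "W \<subseteq> V"
        "pull F W U \<one> s = pull F W V \<one> t"
      by (rule germ_eqD[OF assms x(1) V(1-4)])
    have "germ G X F U s z \<in> N" if "z \<in> W" for z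
    proof -
      have "germ G X F U s z = germ G X F V t z"
        by (rule germ_eqI[OF assms V(1,2) W(1) that W(3-5)])
      then show ?thesis
        using that W(4) V(5) by blast
    qed
    then have "W \<subseteq> {x \<in> topspace (subtopology X U). germ G X F U s x \<in> N}"
      using W(3) unfolding topspace_subtopology_compact_opens[OF assms(2)] by blast
    moreover have "openin (subtopology X U) W"
      using W(1,3) by (simp add: openin_compact_opens openin_open_subtopology assms(2))
    ultimately show "\<exists>T. openin (subtopology X U) T \<and> x \<in> T \<and>
        T \<subseteq> {x \<in> topspace (subtopology X U). germ G X F U s x \<in> N}"
      using W(2) by blast
  qed
qed

text \<open>With \<open>continuous_map_germ\<close>, this makes the topology of the sheaf space the
  final one for all germ sections. It is the tool for every continuity proof for a map out of the
  sheaf space.\<close>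

lemma continuous_map_sheaf_space:
  assumes "G_presheaf G TG X act F"
    and "\<And>U s. U \<in> compact_opens X \<Longrightarrow> s \<in> sect F U \<Longrightarrow>
      continuous_map (subtopology X U) T (\<lambda>x. f (germ G X F U s x))"
  shows "continuous_map (sheaf_space G X F) T f"
  unfolding continuous_map_def
proof (intro conjI allI impI)
  show "f \<in> topspace (sheaf_space G X F) \<rightarrow> topspace T"
  proof
    fix p assume "p \<in> topspace (sheaf_space G X F)"
    then obtain U s x where "U \<in> compact_opens X" "s \<in> sect F U" "x \<in> U" "p = germ G X F U s x"
      by (rule sheaf_space_cases)
    then show "f p \<in> topspace T"
      using assms(2) by (fastforce simp: continuous_map_def dest: in_compact_opens)
  qed
  fix N assume N: "openin T N"
  show "openin (sheaf_space G X F) {p \<in> topspace (sheaf_space G X F). f p \<in> N}"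
  proof (subst openin_subopen, intro ballI)
    fix p assume p: "p \<in> {p \<in> topspace (sheaf_space G X F). f p \<in> N}"
    then obtain U s x where U: "U \<in> compact_opens X" "s \<in> sect F U" "x \<in> U" "p = germ G X F U s x"
      using sheaf_space_cases[of p F] by blast
    have "openin (subtopology X U) {x \<in> topspace (subtopology X U). f (germ G X F U s x) \<in> N}"
      by (rule openin_continuous_map_preimage[OF assms(2)[OF U(1,2)] N])
    then have "openin X {x \<in> U. f (germ G X F U s x) \<in> N}"
      unfolding topspace_subtopology_compact_opens[OF U(1)]
      by (rule openin_trans_full) (rule openin_compact_opens[OF U(1)])
    moreover have "x \<in> {x \<in> U. f (germ G X F U s x) \<in> N}"
      using U p by simp
    \<comment> \<open>The preimage in \<open>U\<close> is merely open, whereas the presheaf can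
      restrict \<open>s\<close> only to compact open sets; the basis of \<open>X\<close> bridges the
      gap.\<close>
    ultimately obtain W where W: "W \<in> compact_opens X" "x \<in> W"
        "W \<subseteq> {x \<in> U. f (germ G X F U s x) \<in> N}"
      by (rule compact_open_base)
    then have WU: "W \<subseteq> U"
      by blast
    let ?r = "pull F W U \<one> s"
    have r: "?r \<in> sect F W"
      by (rule restrict_closed[OF assms(1) W(1) U(1) WU U(2)])
    have eq: "germ G X F W ?r z = germ G X F U s z" if "z \<in> W" for z
      by (rule germ_restrict[OF assms(1) W(1) U(1) WU U(2) that])
    have "p \<in> germ G X F W ?r ` W"
      unfolding U(4) eq[OF W(2), symmetric] using W(2) by (rule imageI)
    moreover have "germ G X F W ?r z \<in> topspace (sheaf_space G X F) \<and> f (germ G X F W ?r z) \<in> N"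
      if "z \<in> W" for z
      using germ_in_space[OF W(1) that r] W(3) that unfolding eq[OF that] by blast
    then have "germ G X F W ?r ` W \<subseteq> {p \<in> topspace (sheaf_space G X F). f p \<in> N}"
      by blast
    ultimately show "\<exists>T. openin (sheaf_space G X F) T \<and> p \<in> T \<and>
        T \<subseteq> {p \<in> topspace (sheaf_space G X F). f p \<in> N}"
      using openin_germ_image[OF W(1) r] by blast
  qed
qed

text \<open>Composed with a germ section, the projection is the inclusion of \<open>U\<close>, which
  gives its continuity. On the image of that germ section, the section itself is the
  inverse.\<close>

lemma local_homeomorphism_sheaf_space:
  assumes "G_presheaf G TG X act F"
  shows "local_homeomorphism (sheaf_space G X F) X fst"
  unfolding local_homeomorphism_def
proof
  fix p assume "p \<in> topspace (sheaf_space G X F)"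
  then obtain U s x where U: "U \<in> compact_opens X" "s \<in> sect F U" "x \<in> U" "p = germ G X F U s x"
    by (rule sheaf_space_cases)
  let ?N = "germ G X F U s ` U"
  have N: "openin (sheaf_space G X F) ?N"
    by (rule openin_germ_image[OF U(1,2)])
  have img: "fst ` ?N = U"
    by (simp add: image_image)
  have fst: "continuous_map (sheaf_space G X F) X fst"
    by (rule continuous_map_sheaf_space[OF assms]) (simp add: continuous_map_from_subtopology)
  have "homeomorphic_maps (subtopology (sheaf_space G X F) ?N) (subtopology X U) fst (germ G X F U s)"
    unfolding homeomorphic_maps_def
    using fst continuous_map_germ[OF assms U(1,2)] openin_subset[OF N] in_compact_opens[OF U(1)]
    by (auto simp: continuous_map_in_subtopology continuous_map_from_subtopology)
  then have "homeomorphic_map (subtopology (sheaf_space G X F) ?N) (subtopology X (fst ` ?N)) fst"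
    unfolding img by (rule homeomorphic_maps_imp_map)
  then show "\<exists>N. openin (sheaf_space G X F) N \<and> p \<in> N \<and> openin X (fst ` N) \<and>
      homeomorphic_map (subtopology (sheaf_space G X F) N) (subtopology X (fst ` N)) fst"
    using N U img openin_compact_opens by (intro exI[of _ ?N]) auto
qed


subsection \<open>The action on the sheaf space\<close>

lemma pre_star_closed:
  "G_presheaf G TG X act F \<Longrightarrow> g \<in> carrier G \<Longrightarrow> U \<in> compact_opens X \<Longrightarrow> s \<in> sect F U \<Longrightarrow>
    pre_star G act F U g s \<in> sect F (act g ` U)"
  unfolding pre_star_def by (rule pull_closed[OF _ act_image _ inv_orbit_hom])

lemma pre_star_one:
  "G_presheaf G TG X act F \<Longrightarrow> U \<in> compact_opens X \<Longrightarrow> s \<in> sect F U \<Longrightarrow> pre_star G act F U \<one> s = s"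
  unfolding pre_star_def inv_one by (subst act_one_image) (simp_all only: pull_id)

text \<open>Two reversals cancel: \<open>pull\<close> is contravariant and \<open>pre_star\<close>
  pulls back along inverses. Hence \<open>pre_star\<close> is a left action.\<close>

lemma pre_star_mult:
  assumes F: "G_presheaf G TG X act F" and c: "g \<in> carrier G" "h \<in> carrier G"
    and U: "U \<in> compact_opens X" and s: "s \<in> sect F U"
  shows "pre_star G act F U (g \<otimes> h) s = pre_star G act F (act h ` U) g (pre_star G act F U h s)"
  unfolding pre_star_def act_mult_image[OF c U] inv_mult_group[OF c]
  by (rule pull_pull[OF F act_image[OF c(1) act_image[OF c(2) U]] act_image[OF c(2) U] U
      inv_orbit_hom[OF c(1) act_image[OF c(2) U]] inv_orbit_hom[OF c(2) U] s, symmetric])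

lemmas germ_act_germ' = germ_act_germ[OF G_space topspace_TG _ Hausdorff_space]

lemma germ_act_closed:
  assumes F: "G_presheaf G TG X act F" and g: "g \<in> carrier G" and p: "p \<in> topspace (sheaf_space G X F)"
  shows "germ_act G X act F g p \<in> topspace (sheaf_space G X F)"
proof -
  obtain U s x where U: "U \<in> compact_opens X" "s \<in> sect F U" "x \<in> U" "p = germ G X F U s x"
    using p by (rule sheaf_space_cases)
  then show ?thesis
    using germ_in_space[OF act_image[OF g U(1)] _ pre_star_closed[OF F g U(1,2)]]
    by (simp add: germ_act_germ'[OF F g U(1-3)])
qed

lemma group_action_germ_act:
  assumes F: "G_presheaf G TG X act F"
  shows "group_action G (topspace (sheaf_space G X F)) (germ_act G X act F)"
proof (rule group_actionI[OF is_group])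
  show "germ_act G X act F g \<in> extensional (topspace (sheaf_space G X F))" for g
    by (simp add: germ_act_def)
  show "germ_act G X act F g p \<in> topspace (sheaf_space G X F)"
    if "g \<in> carrier G" "p \<in> topspace (sheaf_space G X F)" for g p
    using germ_act_closed[OF F that] .
  fix p assume p: "p \<in> topspace (sheaf_space G X F)"
  then obtain U s x where U: "U \<in> compact_opens X" "s \<in> sect F U" "x \<in> U" "p = germ G X F U s x"
    by (rule sheaf_space_cases)
  note x = in_compact_opens[OF U(1,3)]
  show "germ_act G X act F \<one> p = p"
    using U x by (simp add: germ_act_germ'[OF F] pre_star_one[OF F] act_one_image act_one[OF G_space])
  fix g h assume c: "g \<in> carrier G" "h \<in> carrier G"
  have "germ_act G X act F g (germ_act G X act F h p) =
      germ G X F (act g ` act h ` U) (pre_star G act F (act h ` U) g (pre_star G act F U h s)) (act g (act h x))"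
    using U(3) unfolding U(4) germ_act_germ'[OF F c(2) U(1-3)]
    by (intro germ_act_germ'[OF F c(1) act_image[OF c(2) U(1)] pre_star_closed[OF F c(2) U(1,2)]]) auto
  then show "germ_act G X act F (g \<otimes> h) p = germ_act G X act F g (germ_act G X act F h p)"
    using c x unfolding U(4) germ_act_germ'[OF F m_closed[OF c] U(1-3)]
    by (simp add: pre_star_mult[OF F c U(1,2)] act_mult_image[OF c U(1)] act_mult[OF G_space])
qed

text \<open>The continuity clause of a presheaf is used through this lemma alone. It gives openness
  inside the stabilizer of \<open>U\<close>, which passes to the whole group because that stabilizer
  is itself open.\<close>

lemma openin_section_stabilizer:
  assumes F: "G_presheaf G TG X act F" and U: "U \<in> compact_opens X" "s \<in> sect F U"
  shows "openin TG {g \<in> carrier G. act g ` U = U \<and> pre_star G act F U g s = s}"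
proof -
  let ?S = "stabilizer G (\<lambda>g. (`) (act g)) U"
  have "continuous_map (prod_topology (subtopology TG ?S) (discrete_topology (sect F U)))
      (discrete_topology (sect F U)) (\<lambda>(g, s). pre_star G act F U g s)"
    using F U(1) unfolding G_presheaf_def by blast
  then have "continuous_map (subtopology TG ?S) (discrete_topology (sect F U)) (\<lambda>g. pre_star G act F U g s)"
    using U(2) by (simp add: continuous_map_prod_discrete_iff)
  then have "openin (subtopology TG ?S) {g \<in> topspace (subtopology TG ?S). pre_star G act F U g s = s}"
    using U(2) unfolding continuous_map_into_discrete_iff by blast
  then have "openin TG {g \<in> topspace (subtopology TG ?S). pre_star G act F U g s = s}"
    using openin_trans_full openin_stabilizer[OF U(1)] by blast
  moreover have "{g \<in> topspace (subtopology TG ?S). pre_star G act F U g s = s} =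
      {g \<in> carrier G. act g ` U = U \<and> pre_star G act F U g s = s}"
    by (auto simp: stabilizer_def)
  ultimately show ?thesis
    by simp
qed

lemma continuous_map_germ_act:
  assumes F: "G_presheaf G TG X act F"
  shows "continuous_map (prod_topology TG (sheaf_space G X F)) (sheaf_space G X F)
    (\<lambda>(g, p). germ_act G X act F g p)"
  unfolding continuous_map_def
proof (intro conjI allI impI)
  let ?L = "sheaf_space G X F" and ?a = "germ_act G X act F"
  show "(\<lambda>(g, p). ?a g p) \<in> topspace (prod_topology TG ?L) \<rightarrow> topspace ?L"
    using germ_act_closed[OF F] by auto
  fix N assume N: "openin ?L N"
  show "openin (prod_topology TG ?L) {q \<in> topspace (prod_topology TG ?L). (\<lambda>(g, p). ?a g p) q \<in> N}"
    unfolding openin_prod_topology_alt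
  proof (intro allI impI)
    fix g p
    assume "(g, p) \<in> {q \<in> topspace (prod_topology TG ?L). (\<lambda>(g, p). ?a g p) q \<in> N}"
    then have g: "g \<in> carrier G" and p: "p \<in> topspace ?L" and gp: "?a g p \<in> N"
      by auto
    obtain U s x where U: "U \<in> compact_opens X" "s \<in> sect F U" "x \<in> U" "p = germ G X F U s x"
      using p by (rule sheaf_space_cases)
    let ?gU = "act g ` U" and ?gs = "pre_star G act F U g s"
    have gU: "?gU \<in> compact_opens X" "?gs \<in> sect F ?gU"
      using act_image[OF g U(1)] pre_star_closed[OF F g U(1,2)] by auto
    have act_germ: "?a g (germ G X F U s y) = germ G X F ?gU ?gs (act g y)" if "y \<in> U" for y
      by (rule germ_act_germ'[OF F g U(1,2) that])
    obtain V t where Vt: "V \<in> compact_opens X" "t \<in> sect F V"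
        "germ G X F ?gU ?gs (act g x) \<in> germ G X F V t ` V" "germ G X F V t ` V \<subseteq> N"
      by (rule openin_sheaf_spaceE[OF F N gp[unfolded U(4) act_germ[OF U(3)]]])
    from Vt(3) obtain y where "germ G X F ?gU ?gs (act g x) = germ G X F V t y" "y \<in> V"
      by (rule imageE)
    note V = Vt(1,2) this(2,1) Vt(4)
    obtain W' where W': "W' \<in> compact_opens X" "act g x \<in> W'" "W' \<subseteq> ?gU" "W' \<subseteq> V"
        "pull F W' ?gU \<one> ?gs = pull F W' V \<one> t"
      by (rule germ_eqD[OF F gU imageI[OF U(3)] V(1-4)])
    \<comment> \<open>On \<open>W'\<close> the sections \<open>g * s\<close> and \<open>t\<close>
      have the same germs, and those of \<open>t\<close> lie in \<open>N\<close>.\<close>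
    have in_N: "germ G X F ?gU ?gs z \<in> N" if "z \<in> W'" for z
      unfolding germ_eqI[OF F gU V(1,2) W'(1) that W'(3-5)] using that W'(4) V(5) by blast
    \<comment> \<open>Translating \<open>W'\<close> back by \<open>inv g\<close> gives a
      neighbourhood of \<open>x\<close> inside \<open>U\<close> that \<open>g\<close> maps exactly
      onto \<open>W'\<close>.\<close>
    define W where "W = act (inv g) ` W'"
    have W: "W \<in> compact_opens X"
      unfolding W_def using act_image[OF inv_closed[OF g] W'(1)] .
    have WU: "W \<subseteq> U"
      using image_mono[OF W'(3), of "act (inv g)"] act_inv_image(1)[OF g U(1)] by (simp add: W_def)
    have gW: "act g ` W = W'"
      unfolding W_def by (rule act_inv_image(2)[OF g W'(1)])
    have xW: "x \<in> W"
      using imageI[OF W'(2), of "act (inv g)"] act_inv[OF G_space g in_compact_opens[OF U(1,3)]]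
      by (simp add: W_def)
    define r where "r = pull F W U \<one> s"
    have r: "r \<in> sect F W"
      unfolding r_def by (rule restrict_closed[OF F W U(1) WU U(2)])
    have germ_r: "germ G X F W r y = germ G X F U s y" if "y \<in> W" for y
      unfolding r_def by (rule germ_restrict[OF F W U(1) WU U(2) that])
    \<comment> \<open>\<open>?H\<close> is the stabilizer of the pair \<open>(W, r)\<close>, and
      \<open>?gH\<close> is its left coset through \<open>g\<close>. Writing the coset as a preimage
      under multiplication by \<open>inv g\<close> makes its openness immediate.\<close>
    let ?H = "{h \<in> carrier G. act h ` W = W \<and> pre_star G act F W h r = r}"
    let ?gH = "{k \<in> topspace TG. inv g \<otimes> k \<in> ?H}"
    have gH: "openin TG ?gH"
      by (rule openin_continuous_map_preimage[OF continuous_map_mult_left[OF inv_closed[OF g]]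
            openin_section_stabilizer[OF F W r]])
    have rW: "openin ?L (germ G X F W r ` W)"
      by (rule openin_germ_image[OF W r])
    have ggH: "g \<in> ?gH"
      using g act_one_image[OF W] pre_star_one[OF F W r] by simp
    have prW: "p \<in> germ G X F W r ` W"
      unfolding U(4) germ_r[OF xW, symmetric] using xW by (rule imageI)
    have sub: "(k, germ G X F W r y) \<in> topspace (prod_topology TG ?L) \<and> ?a k (germ G X F W r y) \<in> N"
      if "k \<in> ?gH" and y: "y \<in> W" for k y
    proof -
      have k: "k \<in> topspace TG" "inv g \<otimes> k \<in> carrier G" "act (inv g \<otimes> k) ` W = W"
        "pre_star G act F W (inv g \<otimes> k) r = r"
        using \<open>k \<in> ?gH\<close> by simp_all
      let ?h = "inv g \<otimes> k"
      have q: "germ G X F W r y \<in> topspace ?L"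
        by (rule germ_in_space[OF W y r])
      have hy: "act ?h y \<in> W"
        using k(3) y by blast
      \<comment> \<open>The factor from \<open>?H\<close> acts first: it sends the germ of
        \<open>r\<close> at \<open>y\<close> to the germ of \<open>r\<close> at another point of
        \<open>W\<close>. Only then does \<open>g\<close> act, and it carries germs of
        \<open>r\<close> over \<open>W\<close> into \<open>N\<close>.\<close>
      have "k = g \<otimes> ?h"
        using g k(1) by (simp flip: m_assoc)
      then have "?a k (germ G X F W r y) = ?a g (?a ?h (germ G X F W r y))"
        using group_action.composition_rule[OF group_action_germ_act[OF F] q g k(2)] by simp
      also have "?a ?h (germ G X F W r y) = germ G X F W r (act ?h y)"
        unfolding germ_act_germ'[OF F k(2) W r y] k(3,4) ..
      also have "?a g \<dots> = germ G X F ?gU ?gs (act g (act ?h y))"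
        unfolding germ_r[OF hy] by (rule act_germ[OF subsetD[OF WU hy]])
      also have "\<dots> \<in> N"
        using in_N gW hy by blast
      finally show ?thesis
        using k(1) q by simp
    qed
    have "?gH \<times> germ G X F W r ` W \<subseteq>
        {q \<in> topspace (prod_topology TG ?L). (\<lambda>(g, p). ?a g p) q \<in> N}"
    proof
      fix q assume "q \<in> ?gH \<times> germ G X F W r ` W"
      then obtain k p' where q: "k \<in> ?gH" "p' \<in> germ G X F W r ` W" "q = (k, p')"
        by (rule SigmaE)
      from q(2) obtain y where y: "p' = germ G X F W r y" "y \<in> W"
        by (rule imageE)
      show "q \<in> {q \<in> topspace (prod_topology TG ?L). (\<lambda>(g, p). ?a g p) q \<in> N}"
        unfolding q(3) y(1) mem_Collect_eq split by (rule sub[OF q(1) y(2)])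
    qed
    with gH rW ggH prW show "\<exists>A B. openin TG A \<and> openin ?L B \<and> g \<in> A \<and> p \<in> B \<and>
        A \<times> B \<subseteq> {q \<in> topspace (prod_topology TG ?L). (\<lambda>(g, p). ?a g p) q \<in> N}"
      by (intro exI conjI)
  qed
qed

lemma sheafify_simps [simp]:
  "total (sheafify G X act F) = sheaf_space G X F"
  "proj (sheafify G X act F) = fst"
  "gact (sheafify G X act F) = germ_act G X act F"
  by (simp_all add: sheafify_def)

theorem sheafify_sheaf:
  assumes F: "G_presheaf G TG X act F"
  shows "G_sheaf G TG X act (sheafify G X act F)"
  unfolding G_sheaf_def G_space_def
proof (intro conjI ballI)
  fix g p assume g: "g \<in> carrier G" and "p \<in> topspace (total (sheafify G X act F))"
  then have "p \<in> topspace (sheaf_space G X F)"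
    by simp
  then obtain U s x where U: "U \<in> compact_opens X" "s \<in> sect F U" "x \<in> U" "p = germ G X F U s x"
    by (rule sheaf_space_cases)
  then show "proj (sheafify G X act F) (gact (sheafify G X act F) g p) =
      act g (proj (sheafify G X act F) p)"
    by (simp add: germ_act_germ'[OF F g])
qed (use F group_action_germ_act continuous_map_germ_act local_homeomorphism_sheaf_space in auto)


subsection \<open>Morphisms out of a sheaf space\<close>

text \<open>Every point is a germ, the topology is final for the germ sections, and the action is
  known on germs; so all conditions on a morphism can be checked on representatives.\<close>

lemma sheaf_hom_sheafifyI:
  assumes F: "G_presheaf G TG X act F" and ext: "f \<in> extensional (topspace (sheaf_space G X F))"
    and cont: "\<And>U s. U \<in> compact_opens X \<Longrightarrow> s \<in> sect F U \<Longrightarrow>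
      continuous_map (subtopology X U) (total E) (\<lambda>x. f (germ G X F U s x))"
    and proj: "\<And>U s x. U \<in> compact_opens X \<Longrightarrow> s \<in> sect F U \<Longrightarrow> x \<in> U \<Longrightarrow>
      proj E (f (germ G X F U s x)) = x"
    and equi: "\<And>U s x g. U \<in> compact_opens X \<Longrightarrow> s \<in> sect F U \<Longrightarrow> x \<in> U \<Longrightarrow> g \<in> carrier G \<Longrightarrow>
      f (germ G X F (act g ` U) (pre_star G act F U g s) (act g x)) = gact E g (f (germ G X F U s x))"
  shows "f \<in> sheaf_hom G (sheafify G X act F) E"
  unfolding sheaf_hom_def mem_Collect_eq sheafify_simps
proof (intro conjI ballI)
  show "continuous_map (sheaf_space G X F) (total E) f"
    by (rule continuous_map_sheaf_space[OF F cont])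
  fix p assume "p \<in> topspace (sheaf_space G X F)"
  then obtain U s x where U: "U \<in> compact_opens X" "s \<in> sect F U" "x \<in> U" "p = germ G X F U s x"
    by (rule sheaf_space_cases)
  show "proj E (f p) = fst p"
    unfolding U(4) fst_germ by (rule proj[OF U(1-3)])
  show "f (germ_act G X act F g p) = gact E g (f p)" if "g \<in> carrier G" for g
    unfolding U(4) germ_act_germ'[OF F that U(1-3)] by (rule equi[OF U(1-3) that])
qed (rule ext)

lemma sheaf_hom_sheafify_ext:
  assumes "f \<in> sheaf_hom G (sheafify G X act F) E" "f' \<in> sheaf_hom G (sheafify G X act F) E'"
    and "\<And>U s x. U \<in> compact_opens X \<Longrightarrow> s \<in> sect F U \<Longrightarrow> x \<in> U \<Longrightarrow>
      f (germ G X F U s x) = f' (germ G X F U s x)"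
  shows "f = f'"
proof (rule sheaf_hom_ext[OF assms(1,2)])
  fix p assume "p \<in> topspace (total (sheafify G X act F))"
  then have "p \<in> topspace (sheaf_space G X F)"
    by simp
  then obtain U s x where U: "U \<in> compact_opens X" "s \<in> sect F U" "x \<in> U" "p = germ G X F U s x"
    by (rule sheaf_space_cases)
  show "f p = f' p"
    unfolding U(4) by (rule assms(3)[OF U(1-3)])
qed

lemma germ_in_sheafify:
  "U \<in> compact_opens X \<Longrightarrow> x \<in> U \<Longrightarrow> s \<in> sect F U \<Longrightarrow>
    germ G X F U s x \<in> topspace (total (sheafify G X act F))"
  by (simp add: germ_in_space)

section \<open>Sheafification on morphisms\<close>

lemmas sheafify_map_germ' = sheafify_map_germ[OF G_space _ _ Hausdorff_space]

lemma presheaf_hom_pre_star: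
  assumes "\<phi> \<in> presheaf_hom G X act F F'" "U \<in> compact_opens X" "s \<in> sect F U" "g \<in> carrier G"
  shows "\<phi> (act g ` U) (pre_star G act F U g s) = pre_star G act F' U g (\<phi> U s)"
  unfolding pre_star_def
  by (rule presheaf_hom_natural[OF assms(1) act_image[OF assms(4,2)] assms(2) inv_orbit_hom[OF assms(4,2)] assms(3)])

lemma sheafify_map_in_hom:
  assumes F: "G_presheaf G TG X act F" and F': "G_presheaf G TG X act F'"
    and \<phi>: "\<phi> \<in> presheaf_hom G X act F F'"
  shows "sheafify_map G X F F' \<phi> \<in> sheaf_hom G (sheafify G X act F) (sheafify G X act F')"
proof (rule sheaf_hom_sheafifyI[OF F])
  show "sheafify_map G X F F' \<phi> \<in> extensional (topspace (sheaf_space G X F))"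
    by (simp add: sheafify_map_def)
  fix U s assume U: "U \<in> compact_opens X" "s \<in> sect F U"
  note mem = presheaf_hom_closed[OF \<phi> U]
  have eq: "sheafify_map G X F F' \<phi> (germ G X F U s x) = germ G X F' U (\<phi> U s) x" if "x \<in> U" for x
    by (rule sheafify_map_germ'[OF F F' \<phi> U that])
  have "continuous_map (subtopology X U) (sheaf_space G X F') (germ G X F' U (\<phi> U s))"
    by (rule continuous_map_germ[OF F' U(1) mem])
  then have "continuous_map (subtopology X U) (sheaf_space G X F')
      (\<lambda>x. sheafify_map G X F F' \<phi> (germ G X F U s x))"
    by (rule continuous_map_eq) (simp add: eq)
  then show "continuous_map (subtopology X U) (total (sheafify G X act F'))
      (\<lambda>x. sheafify_map G X F F' \<phi> (germ G X F U s x))"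
    by simp
  fix x assume x: "x \<in> U"
  show "proj (sheafify G X act F') (sheafify_map G X F F' \<phi> (germ G X F U s x)) = x"
    unfolding eq[OF x] by simp
  fix g assume g: "g \<in> carrier G"
  show "sheafify_map G X F F' \<phi> (germ G X F (act g ` U) (pre_star G act F U g s) (act g x)) =
      gact (sheafify G X act F') g (sheafify_map G X F F' \<phi> (germ G X F U s x))"
    unfolding eq[OF x] sheafify_simps germ_act_germ'[OF F' g U(1) mem x]
      sheafify_map_germ'[OF F F' \<phi> act_image[OF g U(1)] pre_star_closed[OF F g U] imageI[OF x]]
      presheaf_hom_pre_star[OF \<phi> U g] ..
qed

lemma sheafify_map_id:
  assumes F: "G_presheaf G TG X act F"
  shows "sheafify_map G X F F (presheaf_id X F) = sheaf_id (sheafify G X act F)"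
  by (rule sheaf_hom_sheafify_ext[OF sheafify_map_in_hom[OF F F presheaf_id_in_hom[OF F]]
        sheaf_id_in_hom[OF sheafify_sheaf[OF F]]])
    (simp only: sheafify_map_germ'[OF F F presheaf_id_in_hom[OF F]],
      simp add: sheaf_id_def presheaf_id_def germ_in_space)

lemma sheafify_map_comp:
  assumes F: "G_presheaf G TG X act F" "G_presheaf G TG X act F'" "G_presheaf G TG X act F''"
    and \<phi>: "\<phi> \<in> presheaf_hom G X act F F'" and \<psi>: "\<psi> \<in> presheaf_hom G X act F' F''"
  shows "sheafify_map G X F F'' (presheaf_comp X F \<psi> \<phi>) =
    sheaf_comp (sheafify G X act F) (sheafify_map G X F' F'' \<psi>) (sheafify_map G X F F' \<phi>)"
proof (rule sheaf_hom_sheafify_ext)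
  show "sheafify_map G X F F'' (presheaf_comp X F \<psi> \<phi>) \<in> sheaf_hom G (sheafify G X act F) (sheafify G X act F'')"
    by (rule sheafify_map_in_hom[OF F(1,3) presheaf_comp_in_hom[OF F(1) \<phi> \<psi>]])
  show "sheaf_comp (sheafify G X act F) (sheafify_map G X F' F'' \<psi>) (sheafify_map G X F F' \<phi>)
      \<in> sheaf_hom G (sheafify G X act F) (sheafify G X act F'')"
    by (rule sheaf_comp_in_hom[OF sheafify_sheaf[OF F(1)] sheafify_map_in_hom[OF F(1,2) \<phi>]
          sheafify_map_in_hom[OF F(2,3) \<psi>]])
  fix U s x assume U: "U \<in> compact_opens X" "s \<in> sect F U" "x \<in> U"
  show "sheafify_map G X F F'' (presheaf_comp X F \<psi> \<phi>) (germ G X F U s x) =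
      sheaf_comp (sheafify G X act F) (sheafify_map G X F' F'' \<psi>) (sheafify_map G X F F' \<phi>) (germ G X F U s x)"
    unfolding sheafify_map_germ'[OF F(1,3) presheaf_comp_in_hom[OF F(1) \<phi> \<psi>] U]
      sheaf_comp_apply[OF germ_in_sheafify[OF U(1,3,2)]] sheafify_map_germ'[OF F(1,2) \<phi> U]
      sheafify_map_germ'[OF F(2,3) \<psi> U(1) presheaf_hom_closed[OF \<phi> U(1,2)] U(3)]
      presheaf_comp_apply[OF U(1,2)] ..
qed

text \<open>The existence half of the universal property; uniqueness is
  \<open>sheaf_hom_sheafify_ext\<close>. The value at a germ does not depend on the representative:
  sections with the same germ coincide on some compact open \<open>W\<close> containing the point,
  and by naturality so do their images under \<phi>.\<close>

lemma sheafify_lift: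
  assumes F: "G_presheaf G TG X act F" and E: "G_sheaf G TG X act E"
    and \<phi>: "\<phi> \<in> presheaf_hom G X act F (forget G X act E)"
  obtains f where "f \<in> sheaf_hom G (sheafify G X act F) E"
    "\<And>U s x. U \<in> compact_opens X \<Longrightarrow> s \<in> sect F U \<Longrightarrow> x \<in> U \<Longrightarrow> f (germ G X F U s x) = \<phi> U s x"
proof -
  have sec: "\<phi> U s \<in> sections X E U" if "U \<in> compact_opens X" "s \<in> sect F U" for U s
    using presheaf_hom_closed[OF \<phi> that] by simp
  have res: "\<phi> W (pull F W U \<one> s) = restrict (\<phi> U s) W"
    if "W \<in> compact_opens X" "U \<in> compact_opens X" "W \<subseteq> U" "s \<in> sect F U" for W U s
    using presheaf_hom_natural[OF \<phi> that(1,2) one_orbit_hom[OF G_space that(1,3)] that(4)]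
      pull_forget_one[OF E that(1-3) sec[OF that(2,4)]] by simp
  have wd: "\<phi> V t y = \<phi> U s x"
    if U: "U \<in> compact_opens X" "s \<in> sect F U" "x \<in> U" and V: "V \<in> compact_opens X" "t \<in> sect F V" "y \<in> V"
      and eq: "germ G X F U s x = germ G X F V t y" for U s x V t y
  proof -
    obtain W where W: "y = x" "W \<in> compact_opens X" "x \<in> W" "W \<subseteq> U" "W \<subseteq> V"
        "pull F W U \<one> s = pull F W V \<one> t"
      by (rule germ_eqD[OF F U V eq])
    have "restrict (\<phi> U s) W = restrict (\<phi> V t) W"
      using res[OF W(2) U(1) W(4) U(2)] res[OF W(2) V(1) W(5) V(2)] W(6) by simp
    from fun_cong[OF this, of x] show ?thesis
      using W(1,3) by simp
  qed
  define f where "f = (\<lambda>p \<in> topspace (sheaf_space G X F).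
      THE e. \<exists>U s x. U \<in> compact_opens X \<and> s \<in> sect F U \<and> x \<in> U \<and> p = germ G X F U s x \<and> e = \<phi> U s x)"
  have f: "f (germ G X F U s x) = \<phi> U s x" if U: "U \<in> compact_opens X" "s \<in> sect F U" "x \<in> U" for U s x
  proof -
    have "(THE e. \<exists>V t y. V \<in> compact_opens X \<and> t \<in> sect F V \<and> y \<in> V \<and>
        germ G X F U s x = germ G X F V t y \<and> e = \<phi> V t y) = \<phi> U s x"
    proof (rule the_equality)
      show "\<exists>V t y. V \<in> compact_opens X \<and> t \<in> sect F V \<and> y \<in> V \<and>
          germ G X F U s x = germ G X F V t y \<and> \<phi> U s x = \<phi> V t y"
        using U by (intro exI[of _ U] exI[of _ s] exI[of _ x]) simp
    next
      fix e assume "\<exists>V t y. V \<in> compact_opens X \<and> t \<in> sect F V \<and> y \<in> V \<and>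
          germ G X F U s x = germ G X F V t y \<and> e = \<phi> V t y"
      then show "e = \<phi> U s x"
        by (elim exE conjE) (simp only: wd[OF U])
    qed
    then show ?thesis
      unfolding f_def restrict_apply'[OF germ_in_space[OF U(1,3,2)]] .
  qed
  have "f \<in> sheaf_hom G (sheafify G X act F) E"
  proof (rule sheaf_hom_sheafifyI[OF F])
    show "f \<in> extensional (topspace (sheaf_space G X F))"
      by (simp add: f_def)
    fix U s assume U: "U \<in> compact_opens X" "s \<in> sect F U"
    show "continuous_map (subtopology X U) (total E) (\<lambda>x. f (germ G X F U s x))"
      by (rule continuous_map_eq[OF sections_continuous_map[OF sec[OF U]]]) (use U in \<open>simp add: f\<close>)
    fix x assume x: "x \<in> U"
    show "proj E (f (germ G X F U s x)) = x"
      unfolding f[OF U x] by (rule proj_section[OF sec[OF U] x])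
    fix g assume g: "g \<in> carrier G"
    show "f (germ G X F (act g ` U) (pre_star G act F U g s) (act g x)) = gact E g (f (germ G X F U s x))"
      unfolding f[OF U x] f[OF act_image[OF g U(1)] pre_star_closed[OF F g U] imageI[OF x]]
        presheaf_hom_pre_star[OF \<phi> U g] pre_star_forget[OF U(1) g]
      using x act_inv[OF G_space g in_compact_opens[OF U(1) x]] by simp
  qed
  then show ?thesis
    using f by (rule that)
qed


subsection \<open>The adjunction\<close>

lemma sheafify_unit_apply:
  "U \<in> compact_opens X \<Longrightarrow> s \<in> sect F U \<Longrightarrow> x \<in> U \<Longrightarrow> sheafify_unit G X F U s x = germ G X F U s x"
  by (simp add: sheafify_unit_def)

lemma sheafify_unit_in_hom:
  assumes F: "G_presheaf G TG X act F"
  shows "sheafify_unit G X F \<in> presheaf_hom G X act F (forget G X act (sheafify G X act F))"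
proof (rule presheaf_homI)
  fix U s assume U: "U \<in> compact_opens X" "s \<in> sect F U"
  have "continuous_map (subtopology X U) (sheaf_space G X F) (\<lambda>x \<in> U. germ G X F U s x)"
    by (rule continuous_map_eq[OF continuous_map_germ[OF F U]]) (use U in auto)
  then show "sheafify_unit G X F U s \<in> sect (forget G X act (sheafify G X act F)) U"
    using U by (simp add: sheafify_unit_def sections_def)
next
  fix U V g s
  assume U: "U \<in> compact_opens X" "V \<in> compact_opens X" and g: "g \<in> orbit_hom G act U V"
    and s: "s \<in> sect F V"
  note gc = orbit_hom_carrier[OF g]
  \<comment> \<open>The morphism \<open>g\<close> factors as the inclusion of \<open>U\<close> into
    \<open>?V\<close>, followed by the isomorphism from \<open>?V\<close> to \<open>V\<close> given
    by \<open>g\<close>. The first factor is treated by \<open>germ_restrict\<close>, the second by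
    the germ action.\<close>
  let ?V = "act (inv g) ` V"
  have V: "?V \<in> compact_opens X"
    by (rule act_image[OF inv_closed[OF gc] U(2)])
  have UV: "U \<subseteq> ?V"
  proof
    fix x assume "x \<in> U"
    then show "x \<in> ?V"
      using imageI[OF orbit_hom_image[OF g], of x "act (inv g)"] act_inv[OF G_space gc in_compact_opens[OF U(1)]]
      by simp
  qed
  have t: "pre_star G act F V (inv g) s \<in> sect F ?V"
    by (rule pre_star_closed[OF F inv_closed[OF gc] U(2) s])
  have pull: "pull F U V g s = pull F U ?V \<one> (pre_star G act F V (inv g) s)"
    using pull_pull[OF F U(1) V U(2) one_orbit_hom[OF G_space U(1) UV] _ s, of g]
      inv_orbit_hom[OF inv_closed[OF gc] U(2)] gc
    by (simp add: pre_star_def)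
  have "germ G X F U (pull F U V g s) x = germ_act G X act F (inv g) (germ G X F V s (act g x))"
    if x: "x \<in> U" for x
    unfolding pull germ_act_germ'[OF F inv_closed[OF gc] U(2) s orbit_hom_image[OF g x]]
      act_inv[OF G_space gc in_compact_opens[OF U(1) x]]
    by (rule germ_restrict[OF F U(1) V UV t x])
  then show "sheafify_unit G X F U (pull F U V g s) =
      pull (forget G X act (sheafify G X act F)) U V g (sheafify_unit G X F V s)"
    using U s orbit_hom_image[OF g] pull_closed[OF F U g s]
    by (auto simp: pull_forget[OF U(1) g] sheafify_unit_def intro!: restrict_ext)
qed (auto simp: sheafify_unit_def)

lemma transpose_hom_apply:
  assumes F: "G_presheaf G TG X act F" and U: "U \<in> compact_opens X" "s \<in> sect F U" "x \<in> U"
  shows "transpose_hom G X act F f U s x = f (germ G X F U s x)"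
  using presheaf_hom_closed[OF sheafify_unit_in_hom[OF F] U(1,2)] U
  by (simp add: transpose_hom_def presheaf_comp_apply forget_map_eq compose_def sheafify_unit_apply)

lemma transpose_hom_in_hom:
  assumes "G_presheaf G TG X act F" "f \<in> sheaf_hom G (sheafify G X act F) E"
  shows "transpose_hom G X act F f \<in> presheaf_hom G X act F (forget G X act E)"
  unfolding transpose_hom_def
  by (rule presheaf_comp_in_hom[OF assms(1) sheafify_unit_in_hom[OF assms(1)]
        forget_map_in_hom[OF sheafify_sheaf[OF assms(1)] assms(2)]])

lemma presheaf_hom_forget_ext:
  assumes \<phi>: "\<phi> \<in> presheaf_hom G X act F (forget G X act E)" and \<psi>: "\<psi> \<in> presheaf_hom G X act F (forget G X act E)"
    and eq: "\<And>U s x. U \<in> compact_opens X \<Longrightarrow> s \<in> sect F U \<Longrightarrow> x \<in> U \<Longrightarrow> \<phi> U s x = \<psi> U s x"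
  shows "\<phi> = \<psi>"
proof (rule presheaf_hom_ext[OF \<phi> \<psi>])
  fix U s assume U: "U \<in> compact_opens X" "s \<in> sect F U"
  show "\<phi> U s = \<psi> U s"
    using presheaf_hom_closed[OF \<phi> U] presheaf_hom_closed[OF \<psi> U] unfolding sect_forget
    by (rule sections_ext) (rule eq[OF U])
qed

text \<open>Transposition keeps the value of a morphism at every germ, which gives injectivity;
  \<open>sheafify_lift\<close> gives surjectivity.\<close>

theorem bij_betw_transpose_hom:
  assumes F: "G_presheaf G TG X act F" and E: "G_sheaf G TG X act E"
  shows "bij_betw (transpose_hom G X act F)
    (sheaf_hom G (sheafify G X act F) E) (presheaf_hom G X act F (forget G X act E))"
  unfolding bij_betw_def
proof (intro conjI equalityI subsetI inj_onI)
  fix f f' assume f: "f \<in> sheaf_hom G (sheafify G X act F) E" "f' \<in> sheaf_hom G (sheafify G X act F) E"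
    and eq: "transpose_hom G X act F f = transpose_hom G X act F f'"
  show "f = f'"
  proof (rule sheaf_hom_sheafify_ext[OF f])
    fix U s x assume U: "U \<in> compact_opens X" "s \<in> sect F U" "x \<in> U"
    show "f (germ G X F U s x) = f' (germ G X F U s x)"
      unfolding transpose_hom_apply[OF F U, symmetric] eq ..
  qed
next
  fix \<phi> assume "\<phi> \<in> transpose_hom G X act F ` sheaf_hom G (sheafify G X act F) E"
  then show "\<phi> \<in> presheaf_hom G X act F (forget G X act E)"
    by (elim imageE) (simp only: transpose_hom_in_hom[OF F])
next
  fix \<phi> assume \<phi>: "\<phi> \<in> presheaf_hom G X act F (forget G X act E)"
  obtain f where f: "f \<in> sheaf_hom G (sheafify G X act F) E"
    "\<And>U s x. U \<in> compact_opens X \<Longrightarrow> s \<in> sect F U \<Longrightarrow> x \<in> U \<Longrightarrow> f (germ G X F U s x) = \<phi> U s x"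
    using sheafify_lift[OF F E \<phi>] by blast
  have "\<phi> = transpose_hom G X act F f"
    by (rule presheaf_hom_forget_ext[OF \<phi> transpose_hom_in_hom[OF F f(1)]])
      (simp only: transpose_hom_apply[OF F] f(2))
  then show "\<phi> \<in> transpose_hom G X act F ` sheaf_hom G (sheafify G X act F) E"
    using f(1) by (rule image_eqI)
qed

section \<open>Naturality of the adjunction in both variables\<close>

lemma transpose_hom_comp:
  assumes F: "G_presheaf G TG X act F" and f: "f \<in> sheaf_hom G (sheafify G X act F) E"
  shows "transpose_hom G X act F (sheaf_comp (sheafify G X act F) h f) =
    presheaf_comp X F (forget_map X E h) (transpose_hom G X act F f)"
  unfolding transpose_hom_def forget_map_comp[OF f]
  by (rule presheaf_comp_assoc[OF sheafify_unit_in_hom[OF F], symmetric])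

lemma sheafify_unit_natural:
  assumes F: "G_presheaf G TG X act F" "G_presheaf G TG X act F'" and \<phi>: "\<phi> \<in> presheaf_hom G X act F F'"
  shows "presheaf_comp X F (forget_map X (sheafify G X act F) (sheafify_map G X F F' \<phi>)) (sheafify_unit G X F) =
    presheaf_comp X F (sheafify_unit G X F') \<phi>"
proof (rule presheaf_hom_forget_ext)
  show "presheaf_comp X F (forget_map X (sheafify G X act F) (sheafify_map G X F F' \<phi>)) (sheafify_unit G X F)
      \<in> presheaf_hom G X act F (forget G X act (sheafify G X act F'))"
    using transpose_hom_in_hom[OF F(1) sheafify_map_in_hom[OF F \<phi>]] by (simp add: transpose_hom_def)
  show "presheaf_comp X F (sheafify_unit G X F') \<phi> \<in> presheaf_hom G X act F (forget G X act (sheafify G X act F'))"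
    by (rule presheaf_comp_in_hom[OF F(1) \<phi> sheafify_unit_in_hom[OF F(2)]])
  fix U s x assume U: "U \<in> compact_opens X" "s \<in> sect F U" "x \<in> U"
  show "presheaf_comp X F (forget_map X (sheafify G X act F) (sheafify_map G X F F' \<phi>)) (sheafify_unit G X F) U s x =
      presheaf_comp X F (sheafify_unit G X F') \<phi> U s x"
    unfolding transpose_hom_def[symmetric] transpose_hom_apply[OF F(1) U] sheafify_map_germ'[OF F \<phi> U]
      presheaf_comp_apply[OF U(1,2)] sheafify_unit_apply[OF U(1) presheaf_hom_closed[OF \<phi> U(1,2)] U(3)] ..
qed

text \<open>This is formal: naturality in the sheaf splits off the transpose of
  \<open>sheafify_map\<close>, and naturality of the unit identifies that transpose with the unit of
  \<open>F'\<close> composed with \<phi>.\<close>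

lemma transpose_hom_sheafify_map:
  assumes F: "G_presheaf G TG X act F" "G_presheaf G TG X act F'" and \<phi>: "\<phi> \<in> presheaf_hom G X act F F'"
  shows "transpose_hom G X act F (sheaf_comp (sheafify G X act F) f (sheafify_map G X F F' \<phi>)) =
    presheaf_comp X F (transpose_hom G X act F' f) \<phi>"
  unfolding transpose_hom_comp[OF F(1) sheafify_map_in_hom[OF F \<phi>]]
  unfolding transpose_hom_def sheafify_unit_natural[OF F \<phi>]
  by (rule presheaf_comp_assoc[OF \<phi>])


subsection \<open>Sheaves are recovered from their sections\<close>

lemma section_through:
  assumes E: "G_sheaf G TG X act E" and e: "e \<in> topspace (total E)"
  obtains U s where "U \<in> compact_opens X" "s \<in> sections X E U" "proj E e \<in> U" "s (proj E e) = e"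
proof -
  obtain V s where V: "openin X V" "proj E e \<in> V" "continuous_map (subtopology X V) (total E) s"
      "\<And>x. x \<in> V \<Longrightarrow> proj E (s x) = x" "s (proj E e) = e"
    by (rule local_homeomorphism_section[OF G_sheaf_local_homeomorphism[OF E] e]) blast
  obtain U where U: "U \<in> compact_opens X" "proj E e \<in> U" "U \<subseteq> V"
    by (rule compact_open_base[OF V(1,2)])
  have "continuous_map (subtopology X U) (total E) s"
    by (rule continuous_map_from_subtopology_mono[OF V(3) U(3)])
  then have "continuous_map (subtopology X U) (total E) (restrict s U)"
    by (rule continuous_map_eq) (use U(1) in auto)
  then have "restrict s U \<in> sections X E U"
    using V(4) U(3) by (auto simp: sections_def)
  then show ?thesis
    using U V(5) by (intro that[of U "restrict s U"]) auto
qed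

text \<open>A compact open neighbourhood of \<open>x\<close> inside the open locus where
  \<open>s\<close> and \<open>t\<close> agree is a witness for \<open>germ_rel\<close>. This is what
  makes the counit injective.\<close>

lemma germ_forget_eqI:
  assumes E: "G_sheaf G TG X act E"
    and U: "U \<in> compact_opens X" "s \<in> sections X E U" "x \<in> U"
    and V: "V \<in> compact_opens X" "t \<in> sections X E V" "x \<in> V"
    and eq: "s x = t x"
  shows "germ G X (forget G X act E) U s x = germ G X (forget G X act E) V t x"
proof -
  note UV = compact_opens_Int[OF U(1) V(1)]
  have "openin (subtopology X (U \<inter> V)) {z \<in> topspace (subtopology X (U \<inter> V)). s z = t z}"
    using sections_continuous_map[OF U(2)] sections_continuous_map[OF V(2)]
      proj_section[OF U(2)] proj_section[OF V(2)]
    by (intro openin_local_homeomorphism_equalizer[OF G_sheaf_local_homeomorphism[OF E]])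
      (auto intro: continuous_map_from_subtopology_mono)
  then have "openin X {z \<in> U \<inter> V. s z = t z}"
    unfolding topspace_subtopology_compact_opens[OF UV]
    by (rule openin_trans_full) (rule openin_compact_opens[OF UV])
  then obtain W where W: "W \<in> compact_opens X" "x \<in> W" "W \<subseteq> {z \<in> U \<inter> V. s z = t z}"
    using U(3) V(3) eq by (elim compact_open_base) auto
  then have sub: "W \<subseteq> U" "W \<subseteq> V" and "\<And>z. z \<in> W \<Longrightarrow> s z = t z"
    by auto
  then have "restrict s W = restrict t W"
    by (intro restrict_ext)
  then show ?thesis
    using U V W(1,2) sub
    by (intro germ_eqI[OF forget_presheaf[OF E] U(1) _ V(1) _ W(1,2) sub])
      (simp_all add: pull_forget_one[OF E])
qed

text \<open>Topology is needed only for continuity of the inverse. Its compatibility with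
  projections and actions follows by applying that of \<open>f\<close> to preimages.\<close>

lemma sheaf_isoI:
  assumes E: "G_sheaf G TG X act E" and f: "f \<in> sheaf_hom G E E'"
    and "open_map (total E) (total E') f" "f ` topspace (total E) = topspace (total E')"
    and "inj_on f (topspace (total E))"
  obtains f' where "f' \<in> sheaf_hom G E' E" "sheaf_comp E f' f = sheaf_id E" "sheaf_comp E' f f' = sheaf_id E'"
proof -
  have "homeomorphic_map (total E) (total E') f"
    by (rule bijective_open_imp_homeomorphic_map[OF sheaf_hom_continuous_map[OF f] assms(3-5)])
  then obtain h where "homeomorphic_maps (total E) (total E') f h"
    by (auto simp: homeomorphic_map_maps)
  then have cont: "continuous_map (total E') (total E) h"
    and hf: "\<And>e. e \<in> topspace (total E) \<Longrightarrow> h (f e) = e"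
    and fh: "\<And>e. e \<in> topspace (total E') \<Longrightarrow> f (h e) = e"
    by (auto simp: homeomorphic_maps_def)
  have h: "h e \<in> topspace (total E)" if "e \<in> topspace (total E')" for e
    using cont that by (auto simp: continuous_map_def)
  \<comment> \<open>\<open>homeomorphic_maps\<close> says nothing about \<open>h\<close> outside the
    space, while morphisms of sheaves must be extensional.\<close>
  let ?h = "restrict h (topspace (total E'))"
  have "?h \<in> sheaf_hom G E' E"
    unfolding sheaf_hom_def mem_Collect_eq
  proof (intro conjI ballI)
    show "continuous_map (total E') (total E) ?h"
      by (rule continuous_map_eq[OF cont]) simp
    fix e assume e: "e \<in> topspace (total E')"
    show "proj E (?h e) = proj E' e"
      using sheaf_hom_proj[OF f h[OF e]] fh[OF e] e by simp
    fix g assume g: "g \<in> carrier G"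
    have "gact E' g e = f (gact E g (h e))"
      using sheaf_hom_gact[OF f g h[OF e]] fh[OF e] by simp
    then show "?h (gact E' g e) = gact E g (?h e)"
      using gact_closed[OF E g h[OF e]] hf sheaf_hom_closed[OF f] e by simp
  qed simp
  moreover have "sheaf_comp E ?h f = sheaf_id E"
    using hf sheaf_hom_closed[OF f] by (auto simp: sheaf_comp_def sheaf_id_def compose_def intro!: restrict_ext)
  moreover have "sheaf_comp E' f ?h = sheaf_id E'"
    using fh by (auto simp: sheaf_comp_def sheaf_id_def compose_def intro!: restrict_ext)
  ultimately show ?thesis
    by (rule that)
qed

text \<open>The inverse of the isomorphism \<open>\<delta>\<close> below is the counit of the adjunction.\<close>

lemma counit_inverse:
  assumes E: "G_sheaf G TG X act E"
  obtains \<delta> where "sheaf_iso G E (sheafify G X act (forget G X act E)) \<delta>"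
    "\<And>U s x. U \<in> compact_opens X \<Longrightarrow> s \<in> sections X E U \<Longrightarrow> x \<in> U \<Longrightarrow>
      \<delta> (s x) = germ G X (forget G X act E) U s x"
proof -
  let ?F = "forget G X act E"
  note F = forget_presheaf[OF E]
  note L = sheafify_sheaf[OF F]
  \<comment> \<open>The counit is the morphism corresponding to the identity of \<open>?F\<close>
    under the adjunction; it evaluates the germ of \<open>s\<close> at \<open>x\<close> to
    \<open>s x\<close>.\<close>
  obtain \<epsilon> where \<epsilon>: "\<epsilon> \<in> sheaf_hom G (sheafify G X act ?F) E"
    and "\<And>U s x. U \<in> compact_opens X \<Longrightarrow> s \<in> sect ?F U \<Longrightarrow> x \<in> U \<Longrightarrow>
      \<epsilon> (germ G X ?F U s x) = presheaf_id X ?F U s x"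
    using sheafify_lift[OF F E presheaf_id_in_hom[OF F]] by blast
  then have eval: "\<epsilon> (germ G X ?F U s x) = s x"
    if "U \<in> compact_opens X" "s \<in> sections X E U" "x \<in> U" for U s x
    using that by (simp add: presheaf_id_def)
  have "open_map (sheaf_space G X ?F) (total E) \<epsilon>"
    unfolding open_map_def
  proof (intro allI impI, subst openin_subopen, intro ballI)
    fix N e assume N: "openin (sheaf_space G X ?F) N" and "e \<in> \<epsilon> ` N"
    then obtain p where p: "p \<in> N" "e = \<epsilon> p"
      by blast
    obtain U s where U: "U \<in> compact_opens X" "s \<in> sect ?F U" "p \<in> germ G X ?F U s ` U"
        "germ G X ?F U s ` U \<subseteq> N"
      by (rule openin_sheaf_spaceE[OF F N p(1)])
    have s: "s \<in> sections X E U"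
      using U(2) by simp
    \<comment> \<open>Evaluation turns a basic open set of germs into the image of a section, and
      such images are open in \<open>E\<close>.\<close>
    have img: "\<epsilon> ` germ G X ?F U s ` U = s ` U"
      unfolding image_image by (rule image_cong[OF refl eval[OF U(1) s]])
    have "openin (total E) (s ` U)"
      by (rule openin_section_image[OF G_sheaf_local_homeomorphism[OF E] openin_compact_opens[OF U(1)]
            sections_continuous_map[OF s] proj_section[OF s]])
    moreover have "e \<in> s ` U"
      unfolding img[symmetric] p(2) using U(3) by (rule imageI)
    moreover have "s ` U \<subseteq> \<epsilon> ` N"
      unfolding img[symmetric] using U(4) by (rule image_mono)
    ultimately show "\<exists>T. openin (total E) T \<and> e \<in> T \<and> T \<subseteq> \<epsilon> ` N"
      by (intro exI conjI)
  qed
  moreover have "\<epsilon> ` topspace (sheaf_space G X ?F) = topspace (total E)"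
  proof (intro equalityI subsetI)
    fix e assume "e \<in> \<epsilon> ` topspace (sheaf_space G X ?F)"
    then show "e \<in> topspace (total E)"
      using sheaf_hom_closed[OF \<epsilon>] unfolding sheafify_simps by (elim imageE) simp
  next
    fix e assume "e \<in> topspace (total E)"
    then obtain U s where U: "U \<in> compact_opens X" "s \<in> sections X E U" "proj E e \<in> U" "s (proj E e) = e"
      by (rule section_through[OF E])
    have "e = \<epsilon> (germ G X ?F U s (proj E e))"
      unfolding eval[OF U(1-3)] U(4) ..
    then show "e \<in> \<epsilon> ` topspace (sheaf_space G X ?F)"
      by (rule image_eqI) (rule germ_in_space[OF U(1,3)], simp add: U(2))
  qed
  moreover have "inj_on \<epsilon> (topspace (sheaf_space G X ?F))"
  proof (rule inj_onI)
    fix p q assume "p \<in> topspace (sheaf_space G X ?F)" "q \<in> topspace (sheaf_space G X ?F)"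
      and eq: "\<epsilon> p = \<epsilon> q"
    obtain U s x where U: "U \<in> compact_opens X" "s \<in> sect ?F U" "x \<in> U" "p = germ G X ?F U s x"
      using \<open>p \<in> _\<close> by (rule sheaf_space_cases)
    obtain V t y where V: "V \<in> compact_opens X" "t \<in> sect ?F V" "y \<in> V" "q = germ G X ?F V t y"
      using \<open>q \<in> _\<close> by (rule sheaf_space_cases)
    note s = U(2)[unfolded sect_forget] and t = V(2)[unfolded sect_forget]
    have st: "s x = t y"
      using eq unfolding U(4) V(4) eval[OF U(1) s U(3)] eval[OF V(1) t V(3)] .
    then have "x = y"
      using proj_section[OF s U(3)] proj_section[OF t V(3)] by simp
    with st V(3) show "p = q"
      unfolding U(4) V(4) using germ_forget_eqI[OF E U(1) s U(3) V(1) t] by simp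
  qed
  ultimately obtain \<delta> where \<delta>: "\<delta> \<in> sheaf_hom G E (sheafify G X act ?F)"
      "sheaf_comp (sheafify G X act ?F) \<delta> \<epsilon> = sheaf_id (sheafify G X act ?F)"
      "sheaf_comp E \<epsilon> \<delta> = sheaf_id E"
    by (elim sheaf_isoI[OF L \<epsilon>, unfolded sheafify_simps])
  show ?thesis
  proof (rule that)
    show "sheaf_iso G E (sheafify G X act ?F) \<delta>"
      unfolding sheaf_iso_def using \<delta> \<epsilon> by blast
    fix U s x assume U: "U \<in> compact_opens X" "s \<in> sections X E U" "x \<in> U"
    have p: "germ G X ?F U s x \<in> topspace (total (sheafify G X act ?F))"
      using U by (intro germ_in_sheafify) simp_all
    have "\<delta> (\<epsilon> (germ G X ?F U s x)) = germ G X ?F U s x"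
      using fun_cong[OF \<delta>(2), of "germ G X ?F U s x"] p
      unfolding sheaf_comp_apply[OF p] by (simp add: sheaf_id_def)
    then show "\<delta> (s x) = germ G X ?F U s x"
      unfolding eval[OF U] .
  qed
qed

section \<open>Idempotence\<close>

lemma presheaf_iso_forget_map:
  assumes E: "G_sheaf G TG X act E" "G_sheaf G TG X act E'" and f: "sheaf_iso G E E' f"
  shows "presheaf_iso G X act (forget G X act E) (forget G X act E') (forget_map X E f)"
proof -
  obtain f' where f: "f \<in> sheaf_hom G E E'" and f': "f' \<in> sheaf_hom G E' E"
    and eq: "sheaf_comp E f' f = sheaf_id E" "sheaf_comp E' f f' = sheaf_id E'"
    using f by (auto simp: sheaf_iso_def)
  show ?thesis
    unfolding presheaf_iso_def
    using forget_map_in_hom[OF E(1) f] forget_map_in_hom[OF E(2) f']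
      forget_map_comp[OF f, of f'] forget_map_comp[OF f', of f] eq
    by (intro conjI bexI[of _ "forget_map X E' f'"]) (simp_all add: forget_map_id)
qed

text \<open>The unit sends \<open>s\<close> to the section
  \<open>x \<mapsto> \<delta> (s x)\<close>, so it is the forgetful functor applied to \<delta>, and
  functors preserve isomorphisms.\<close>

lemma sheafify_unit_forget_iso:
  assumes E: "G_sheaf G TG X act E"
  shows "presheaf_iso G X act (forget G X act E)
    (forget G X act (sheafify G X act (forget G X act E))) (sheafify_unit G X (forget G X act E))"
proof -
  let ?F = "forget G X act E"
  note F = forget_presheaf[OF E]
  obtain \<delta> where \<delta>: "sheaf_iso G E (sheafify G X act ?F) \<delta>"
    "\<And>U s x. U \<in> compact_opens X \<Longrightarrow> s \<in> sections X E U \<Longrightarrow> x \<in> U \<Longrightarrow> \<delta> (s x) = germ G X ?F U s x"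
    using counit_inverse[OF E] by blast
  have \<delta>_hom: "\<delta> \<in> sheaf_hom G E (sheafify G X act ?F)"
    using \<delta>(1) by (simp add: sheaf_iso_def)
  have "sheafify_unit G X ?F = forget_map X E \<delta>"
    by (rule presheaf_hom_forget_ext[OF sheafify_unit_in_hom[OF F] forget_map_in_hom[OF E \<delta>_hom]])
      (simp add: sheafify_unit_apply forget_map_eq compose_def \<delta>(2))
  then show ?thesis
    using presheaf_iso_forget_map[OF E sheafify_sheaf[OF F] \<delta>(1)] by simp
qed

text \<open>Here \<delta> is taken for the sheafification of \<open>F\<close>. A germ of
  \<open>s\<close> is a value of the section that the unit assigns to \<open>s\<close>, so \<delta>
  sends it to the germ of that section, exactly as the sheafified unit does.\<close>

lemma sheafify_map_unit_iso:
  assumes F: "G_presheaf G TG X act F"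
  defines "F' \<equiv> forget G X act (sheafify G X act F)"
  shows "sheaf_iso G (sheafify G X act F) (sheafify G X act F') (sheafify_map G X F F' (sheafify_unit G X F))"
proof -
  note L = sheafify_sheaf[OF F]
  have F': "G_presheaf G TG X act F'"
    unfolding F'_def by (rule forget_presheaf[OF L])
  have unit: "sheafify_unit G X F \<in> presheaf_hom G X act F F'"
    unfolding F'_def by (rule sheafify_unit_in_hom[OF F])
  obtain \<delta> where \<delta>: "sheaf_iso G (sheafify G X act F) (sheafify G X act F') \<delta>"
    "\<And>U s x. U \<in> compact_opens X \<Longrightarrow> s \<in> sections X (sheafify G X act F) U \<Longrightarrow> x \<in> U \<Longrightarrow>
      \<delta> (s x) = germ G X F' U s x"
    using counit_inverse[OF L] unfolding F'_def by blast
  have "\<delta> \<in> sheaf_hom G (sheafify G X act F) (sheafify G X act F')"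
    using \<delta>(1) by (simp add: sheaf_iso_def)
  with sheafify_map_in_hom[OF F F' unit]
  have "sheafify_map G X F F' (sheafify_unit G X F) = \<delta>"
  proof (rule sheaf_hom_sheafify_ext)
    fix U s x assume U: "U \<in> compact_opens X" "s \<in> sect F U" "x \<in> U"
    have "sheafify_unit G X F U s \<in> sections X (sheafify G X act F) U"
      using presheaf_hom_closed[OF unit U(1,2)] by (simp add: F'_def)
    from \<delta>(2)[OF U(1) this U(3)]
    show "sheafify_map G X F F' (sheafify_unit G X F) (germ G X F U s x) = \<delta> (germ G X F U s x)"
      unfolding sheafify_map_germ'[OF F F' unit U] sheafify_unit_apply[OF U] by (rule sym)
  qed
  then show ?thesis
    using \<delta>(1) by simp
qed

text \<open>Faithfulness holds because every point of \<open>E\<close> lies on a section over a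
  compact open set. For fullness, a presheaf morphism is lifted to a map from the sheafification of
  \<open>forget G X act E\<close> to \<open>E'\<close> and composed with \<delta>; at
  \<open>s x\<close> the composite is the lift at the germ of \<open>s\<close>, which is
  \<open>\<phi> U s x\<close>.\<close>

theorem bij_betw_forget_map:
  assumes E: "G_sheaf G TG X act E" and E': "G_sheaf G TG X act E'"
  shows "bij_betw (forget_map X E)
    (sheaf_hom G E E') (presheaf_hom G X act (forget G X act E) (forget G X act E'))"
  unfolding bij_betw_def
proof (intro conjI equalityI subsetI inj_onI)
  fix f f' assume f: "f \<in> sheaf_hom G E E'" "f' \<in> sheaf_hom G E E'"
    and eq: "forget_map X E f = forget_map X E f'"
  show "f = f'"
  proof (rule sheaf_hom_ext[OF f])
    fix e assume "e \<in> topspace (total E)"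
    then obtain U s where U: "U \<in> compact_opens X" "s \<in> sections X E U" "proj E e \<in> U" "s (proj E e) = e"
      by (rule section_through[OF E])
    have "forget_map X E f U s (proj E e) = forget_map X E f' U s (proj E e)"
      by (simp only: eq)
    then show "f e = f' e"
      using U by (simp add: forget_map_eq compose_def)
  qed
next
  fix \<phi> assume "\<phi> \<in> forget_map X E ` sheaf_hom G E E'"
  then show "\<phi> \<in> presheaf_hom G X act (forget G X act E) (forget G X act E')"
    by (elim imageE) (simp only: forget_map_in_hom[OF E])
next
  let ?F = "forget G X act E"
  note F = forget_presheaf[OF E]
  fix \<phi> assume \<phi>: "\<phi> \<in> presheaf_hom G X act ?F (forget G X act E')"
  obtain f where f: "f \<in> sheaf_hom G (sheafify G X act ?F) E'"
    "\<And>U s x. U \<in> compact_opens X \<Longrightarrow> s \<in> sect ?F U \<Longrightarrow> x \<in> U \<Longrightarrow> f (germ G X ?F U s x) = \<phi> U s x"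
    using sheafify_lift[OF F E' \<phi>] by blast
  obtain \<delta> where \<delta>: "sheaf_iso G E (sheafify G X act ?F) \<delta>"
    "\<And>U s x. U \<in> compact_opens X \<Longrightarrow> s \<in> sections X E U \<Longrightarrow> x \<in> U \<Longrightarrow> \<delta> (s x) = germ G X ?F U s x"
    using counit_inverse[OF E] by blast
  have "\<delta> \<in> sheaf_hom G E (sheafify G X act ?F)"
    using \<delta>(1) by (simp add: sheaf_iso_def)
  then have f\<delta>: "sheaf_comp E f \<delta> \<in> sheaf_hom G E E'"
    by (rule sheaf_comp_in_hom[OF E _ f(1)])
  have "\<phi> = forget_map X E (sheaf_comp E f \<delta>)"
    by (rule presheaf_hom_forget_ext[OF \<phi> forget_map_in_hom[OF E f\<delta>]])
      (simp add: forget_map_eq compose_def sheaf_comp_apply sections_closed \<delta>(2) f(2))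
  then show "\<phi> \<in> forget_map X E ` sheaf_hom G E E'"
    using f\<delta> by (rule image_eqI)
qed

end

theorem theorem2:
  fixes G :: "('g, 'm) monoid_scheme" and TG :: "'g topology"
    and X :: "'x topology" and act :: "'g \<Rightarrow> 'x \<Rightarrow> 'x"
  assumes "profinite_group G TG"
    and "profinite_space X" and "G_space G TG X act"
  shows
    \<comment> \<open>the forgetful functor\<close>
    "(\<forall>E :: ('g, 'x, 'e) sheaf. G_sheaf G TG X act E \<longrightarrow>
        G_presheaf G TG X act (forget G X act E) \<and>
        forget_map X E (sheaf_id E) = presheaf_id X (forget G X act E)) \<and>
     (\<forall>(E :: ('g, 'x, 'e) sheaf) (E' :: ('g, 'x, 'f) sheaf).
        G_sheaf G TG X act E \<longrightarrow> G_sheaf G TG X act E' \<longrightarrow>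
        (\<forall>f \<in> sheaf_hom G E E'.
           forget_map X E f \<in> presheaf_hom G X act (forget G X act E) (forget G X act E'))) \<and>
     (\<forall>(E :: ('g, 'x, 'e) sheaf) (E' :: ('g, 'x, 'f) sheaf) (E'' :: ('g, 'x, 'h) sheaf).
        G_sheaf G TG X act E \<longrightarrow> G_sheaf G TG X act E' \<longrightarrow> G_sheaf G TG X act E'' \<longrightarrow>
        (\<forall>f \<in> sheaf_hom G E E'. \<forall>f' \<in> sheaf_hom G E' E''.
           forget_map X E (sheaf_comp E f' f) =
             presheaf_comp X (forget G X act E) (forget_map X E' f') (forget_map X E f))) \<and>
     \<comment> \<open>equivariant sheafification is a functor\<close>
     (\<forall>F :: ('g, 'x, 'c) presheaf. G_presheaf G TG X act F \<longrightarrow>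
        G_sheaf G TG X act (sheafify G X act F) \<and>
        sheafify_map G X F F (presheaf_id X F) = sheaf_id (sheafify G X act F)) \<and>
     (\<forall>(F :: ('g, 'x, 'c) presheaf) (F' :: ('g, 'x, 'd) presheaf).
        G_presheaf G TG X act F \<longrightarrow> G_presheaf G TG X act F' \<longrightarrow>
        (\<forall>\<phi> \<in> presheaf_hom G X act F F'.
           sheafify_map G X F F' \<phi> \<in> sheaf_hom G (sheafify G X act F) (sheafify G X act F'))) \<and>
     (\<forall>(F :: ('g, 'x, 'c) presheaf) (F' :: ('g, 'x, 'd) presheaf) (F'' :: ('g, 'x, 'k) presheaf).
        G_presheaf G TG X act F \<longrightarrow> G_presheaf G TG X act F' \<longrightarrow> G_presheaf G TG X act F'' \<longrightarrow>
        (\<forall>\<phi> \<in> presheaf_hom G X act F F'. \<forall>\<psi> \<in> presheaf_hom G X act F' F''.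
           sheafify_map G X F F'' (presheaf_comp X F \<psi> \<phi>) =
             sheaf_comp (sheafify G X act F) (sheafify_map G X F' F'' \<psi>) (sheafify_map G X F F' \<phi>))) \<and>
     \<comment> \<open>adjunction: bijection of hom-sets induced by the unit, natural in both variables\<close>
     (\<forall>(F :: ('g, 'x, 'c) presheaf) (E :: ('g, 'x, 'e) sheaf).
        G_presheaf G TG X act F \<longrightarrow> G_sheaf G TG X act E \<longrightarrow>
        bij_betw (transpose_hom G X act F)
          (sheaf_hom G (sheafify G X act F) E) (presheaf_hom G X act F (forget G X act E))) \<and>
     (\<forall>(F :: ('g, 'x, 'c) presheaf) (E :: ('g, 'x, 'e) sheaf) (E' :: ('g, 'x, 'f) sheaf).
        G_presheaf G TG X act F \<longrightarrow> G_sheaf G TG X act E \<longrightarrow> G_sheaf G TG X act E' \<longrightarrow>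
        (\<forall>f \<in> sheaf_hom G (sheafify G X act F) E. \<forall>h \<in> sheaf_hom G E E'.
           transpose_hom G X act F (sheaf_comp (sheafify G X act F) h f) =
             presheaf_comp X F (forget_map X E h) (transpose_hom G X act F f))) \<and>
     (\<forall>(F :: ('g, 'x, 'c) presheaf) (F' :: ('g, 'x, 'd) presheaf) (E :: ('g, 'x, 'e) sheaf).
        G_presheaf G TG X act F \<longrightarrow> G_presheaf G TG X act F' \<longrightarrow> G_sheaf G TG X act E \<longrightarrow>
        (\<forall>\<phi> \<in> presheaf_hom G X act F F'. \<forall>f \<in> sheaf_hom G (sheafify G X act F') E.
           transpose_hom G X act F (sheaf_comp (sheafify G X act F) f (sheafify_map G X F F' \<phi>)) =
             presheaf_comp X F (transpose_hom G X act F' f) \<phi>)) \<and>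
     \<comment> \<open>idempotence, for presheaves and for sheaf spaces\<close>
     (\<forall>F :: ('g, 'x, 'c) presheaf. G_presheaf G TG X act F \<longrightarrow>
        presheaf_iso G X act
          (forget G X act (sheafify G X act F))
          (forget G X act (sheafify G X act (forget G X act (sheafify G X act F))))
          (sheafify_unit G X (forget G X act (sheafify G X act F))) \<and>
        sheaf_iso G
          (sheafify G X act F)
          (sheafify G X act (forget G X act (sheafify G X act F)))
          (sheafify_map G X F (forget G X act (sheafify G X act F)) (sheafify_unit G X F))) \<and>
     \<comment> \<open>the forgetful functor is fully faithful\<close>
     (\<forall>(E :: ('g, 'x, 'e) sheaf) (E' :: ('g, 'x, 'f) sheaf).
        G_sheaf G TG X act E \<longrightarrow> G_sheaf G TG X act E' \<longrightarrow>
        bij_betw (forget_map X E)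
          (sheaf_hom G E E') (presheaf_hom G X act (forget G X act E) (forget G X act E')))"
proof -
  interpret profinite_G_space G TG X act
    using assms by unfold_locales (simp_all add: profinite_group_def)
  show ?thesis
    \<comment> \<open>Idempotence for presheaves is \<open>sheafify_unit_forget_iso\<close> at the
      sheaf \<open>sheafify G X act F\<close>; hence \<open>sheafify_sheaf\<close> appears among the
      rules for the side conditions.\<close>
    by (intro conjI allI impI ballI)
      ((rule forget_presheaf forget_map_id forget_map_in_hom forget_map_comp sheafify_sheaf sheafify_map_id
          sheafify_map_in_hom sheafify_map_comp bij_betw_transpose_hom transpose_hom_comp
          transpose_hom_sheafify_map sheafify_unit_forget_iso sheafify_map_unit_iso bij_betw_forget_map;
        (assumption | rule sheafify_sheaf)+)+)
qed

end
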